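(* Let $\gamma\in(0,1)$, $T>0$, let $\mathbf{K}:L^2(\mathbb{R})\to L^2(\mathbb{R})$ be given by $\mathcal{F}(\mathbf{K}\theta)(\omega)=E_{\gamma,1}(-|\omega|^2T^\gamma)\mathcal{F}\theta(\omega)$, and let $(u_\lambda,v_\lambda,\kappa_\lambda)_{\lambda\in\Lambda}$ be the wavelet-type diagonal frame decomposition of $\mathbf{K}$ described in the context. Let $\varphi(\mu)=\mu^{p/2}$, $E>0$, $\theta_0\in\mathbf{M}_{\varphi,E}$, $\theta_T=\mathbf{K}\theta_0$, $\|\theta_T^\delta-\theta_T\|\le\delta$, and let $$u_{0\alpha}^\delta=\sum_{\lambda\in\Lambda}\frac{\kappa_\lambda}{\alpha+\kappa_\lambda^2}\langle\theta_T^\delta,v_\lambda\rangle u_\lambda .$$ (a) (a priori regularization) For $0<p\le4$, if the regularization parameter is chosen as $\alpha=(\delta/E)^{\frac{4}{p+2}}$, then $u_{0\alpha}^\delta$ is uniform order optimal over $\mathbf{M}_{\varphi,E}$ and $$\|u_{0\alpha}^\delta-\theta_0\|\le C\,\delta^{\frac{p}{p+2}}E^{\frac{2}{p+2}},$$ with a constant $C$ independent of $\delta$, $E$, $\theta_0$ and $\theta_T^\delta$. (b) (a posteriori regularization) For $0<p\le2$, assume that $\alpha_D$ is chosen by the Morozov principle: for a fixed $\tau>1$ and $B_v$ an upper frame bound of $(v_\lambda)$, $\alpha_D>0$ solves $$\left(\sum_{\lambda\in\Lambda}|\langle\mathbf{K}u_{0\alpha}^\delta-\theta_T^\delta,v_\lambda\rangle|^2\right)^{1/2}=\tau\sqrt{B_v}\,\delta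 .$$ Then $u_{0\alpha_D}^\delta$ is uniform order optimal over $\mathbf{M}_{\varphi,E}$ and $$\|u_{0\alpha_D}^\delta-\theta_0\|\le C\,\delta^{\frac{p}{p+2}}E^{\frac{2}{p+2}},$$ with a constant $C$ independent of $\delta$, $E$, $\theta_0$ and $\theta_T^\delta$.
   Context: $\mathcal{F}f(\omega)=\int_{\mathbb{R}}f(t)e^{-i\omega t}\,dt$ is the Fourier transform on $L^2(\mathbb{R})$; $\langle\cdot,\cdot\rangle$, $\|\cdot\|$ are the inner product and norm of $L^2(\mathbb{R})$. The Mittag-Leffler function is $E_{\alpha,\beta}(z)=\sum_{n\ge0}z^n/\Gamma(\alpha n+\beta)$. ($\mathbf{K}$ maps initial to final values, at time $T$, of the time-fractional heat equation of order $\gamma$ on $\mathbb{R}$.) The system: $\Lambda=\mathbb{Z}^2$; $u_\lambda(x)=2^{\lambda_D/2}\psi(2^{\lambda_D}x-\lambda_T)$, $\lambda=(\lambda_D,\lambda_T)\in\Lambda$, is an orthonormal wavelet basis of $L^2(\mathbb{R})$ with $\operatorname{supp}(\mathcal{F}\psi)\subset\{\omega\in\mathbb{R}:a_u\le|\omega|\le b_u\}$ for positive constants $a_u,b_u$; $\kappa_\lambda=2^{-2\lambda_D}$ if $\lambda_D\ge1$ and $\kappa_\lambda=1$ if $\lambda_D<1$; $v_\lambda$ is given by $\mathcal{F}v_\lambda(\omega)=\kappa_\lambda E_{\gamma,1}(-|\omega|^2T^\gamma)^{-1}\mathcal{F}u_\lambda(\omega)$. This is a diagonal frame decomposition of $\mathbf{K}$: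 $(u_\lambda)$ is a frame over $(\ker\mathbf{K})^\perp$, $(v_\lambda)$ is a frame over $\overline{\mathrm{ran}\,\mathbf{K}}$ (i.e. $A_v\|z\|^2\le\sum_\lambda|\langle z,v_\lambda\rangle|^2\le B_v\|z\|^2$ for all $z\in\overline{\mathrm{ran}\,\mathbf{K}}$ with $0<A_v,B_v<\infty$ the lower and upper frame bounds), and $\mathbf{K}^*v_\lambda=\kappa_\lambda u_\lambda$. Source set: $\mathbf{M}_{\varphi,E}=\{\theta\in L^2(\mathbb{R}):\sum_\lambda[\varphi(\kappa_\lambda^2)]^{-1}|\langle\theta,u_\lambda\rangle|^2\le E^2\}$. Worst-case error of a map $\mathbf{R}:L^2(\mathbb{R})\to L^2(\mathbb{R})$: $\Delta(\mathbf{M},\delta,\mathbf{R})=\sup\{\|\mathbf{R}y^\delta-x\|:x\in\mathbf{M},\ y^\delta\in L^2(\mathbb{R}),\ \|\mathbf{K}x-y^\delta\|\le\delta\}$. A method $\mathbf{R}_{\alpha(\delta,y^\delta)}$ (a regularization with parameter choice) is uniform order optimal over $\mathbf{M}$ if there are $\delta_0>0$ and $c>0$ independent of $\delta$ with $\Delta(\mathbf{M},\delta,\mathbf{R}_{\alpha(\delta,y^\delta)})\le c\inf_{\mathbf{R}}\Delta(\mathbf{M},\delta,\mathbf{R})$ for all $\delta\in(0,\delta_0)$, the infimum being over all maps $\mathbf{R}$. In (b) the supremum for the a posteriori method is over data satisfying the solvability condition $0<\tau\sqrt{B_v}\,\delta<\sqrt{A_v}\,\|P_{\overline{\mathrm{ran}\,\mathbf{K}}}y^\delta\|$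 ($P$ the orthogonal projection), under which the Morozov equation has a solution. *)

theory Defs
  imports "HOL-Analysis.Analysis"
begin

text \<open>The space L2(R) of complex-valued functions is represented by Borel measurable,
  square-integrable functions; elements of the quotient space are equal iff their
  representatives agree almost everywhere.\<close>

definition L2 :: "(real \<Rightarrow> complex) set" where
  "L2 = {f. f \<in> borel_measurable lborel \<and> integrable lborel (\<lambda>x. (cmod (f x))\<^sup>2)}"

definition L2_inner :: "(real \<Rightarrow> complex) \<Rightarrow> (real \<Rightarrow> complex) \<Rightarrow> complex" where
  "L2_inner f g = (LINT x|lborel. f x * cnj (g x))"

definition L2_norm :: "(real \<Rightarrow> complex) \<Rightarrow> real" where
  "L2_norm f = sqrt (LINT x|lborel. (cmod (f x))\<^sup>2)"

text \<open>The nonnegative integral is used because it is infinite, rather than 0, on functions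
  that are not square-integrable.\<close>

definition L2_tendsto ::
    "('i \<Rightarrow> real \<Rightarrow> complex) \<Rightarrow> (real \<Rightarrow> complex) \<Rightarrow> 'i filter \<Rightarrow> bool" where
  "L2_tendsto f g F \<longleftrightarrow>
     ((\<lambda>i. \<integral>\<^sup>+ x. ennreal ((cmod (f i x - g x))\<^sup>2) \<partial>lborel) \<longlongrightarrow> 0) F"

definition L2_has_sum :: "('i \<Rightarrow> real \<Rightarrow> complex) \<Rightarrow> (real \<Rightarrow> complex) \<Rightarrow> bool" where
  "L2_has_sum f s \<longleftrightarrow> s \<in> L2 \<and>
     L2_tendsto (\<lambda>J x. \<Sum>i\<in>J. f i x) s (finite_subsets_at_top UNIV)"

text \<open>The sum is unique only up to almost everywhere equality, so a representative is chosen.\<close>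

definition L2_suminf :: "('i \<Rightarrow> real \<Rightarrow> complex) \<Rightarrow> real \<Rightarrow> complex" where
  "L2_suminf f = (SOME s. L2_has_sum f s)"

definition L2_map :: "((real \<Rightarrow> complex) \<Rightarrow> (real \<Rightarrow> complex)) \<Rightarrow> bool" where
  "L2_map R \<longleftrightarrow> (\<forall>f\<in>L2. R f \<in> L2) \<and>
     (\<forall>f\<in>L2. \<forall>g\<in>L2. (AE x in lborel. f x = g x) \<longrightarrow> (AE x in lborel. R f x = R g x))"

text \<open>The Fourier transform on L2 as the L2-limit of the Fourier integrals of the truncations
  of \<^term>\<open>f\<close> to bounded intervals; \<^term>\<open>g\<close> is determined up to almost everywhere equality.\<close>

definition has_L2_fourier :: "(real \<Rightarrow> complex) \<Rightarrow> (real \<Rightarrow> complex) \<Rightarrow> bool" where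
  "has_L2_fourier f g \<longleftrightarrow> f \<in> L2 \<and> g \<in> L2 \<and>
     L2_tendsto
       (\<lambda>N \<omega>. LINT t:{-N..N}|lborel. f t * exp (- (\<i> * complex_of_real \<omega> * complex_of_real t)))
       g at_top"

definition mittag_leffler :: "real \<Rightarrow> real \<Rightarrow> real \<Rightarrow> real" where
  "mittag_leffler \<alpha> \<beta> z = (\<Sum>n. z ^ n / Gamma (\<alpha> * real n + \<beta>))"

text \<open>Fourier multiplier of the forward operator.\<close>

definition heat_symbol :: "real \<Rightarrow> real \<Rightarrow> real \<Rightarrow> real" where
  "heat_symbol \<gamma> T \<omega> = mittag_leffler \<gamma> 1 (- (\<bar>\<omega>\<bar>\<^sup>2 * T powr \<gamma>))"

definition heat_operator ::
    "real \<Rightarrow> real \<Rightarrow> ((real \<Rightarrow> complex) \<Rightarrow> (real \<Rightarrow> complex)) \<Rightarrow> bool" where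
  "heat_operator \<gamma> T K \<longleftrightarrow> L2_map K \<and>
     (\<forall>\<theta>\<in>L2. \<exists>g. has_L2_fourier \<theta> g \<and>
        has_L2_fourier (K \<theta>) (\<lambda>\<omega>. complex_of_real (heat_symbol \<gamma> T \<omega>) * g \<omega>))"

definition L2_kernel :: "((real \<Rightarrow> complex) \<Rightarrow> (real \<Rightarrow> complex)) \<Rightarrow> (real \<Rightarrow> complex) set" where
  "L2_kernel K = {f \<in> L2. AE x in lborel. K f x = 0}"

definition L2_closed_range ::
    "((real \<Rightarrow> complex) \<Rightarrow> (real \<Rightarrow> complex)) \<Rightarrow> (real \<Rightarrow> complex) set" where
  "L2_closed_range K = {z \<in> L2. \<forall>e>0. \<exists>f\<in>L2. L2_norm (\<lambda>x. K f x - z x) < e}"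

definition L2_orthogonal :: "(real \<Rightarrow> complex) set \<Rightarrow> (real \<Rightarrow> complex) set" where
  "L2_orthogonal V = {f \<in> L2. \<forall>g\<in>V. L2_inner f g = 0}"

definition L2_proj :: "(real \<Rightarrow> complex) set \<Rightarrow> (real \<Rightarrow> complex) \<Rightarrow> (real \<Rightarrow> complex)" where
  "L2_proj V y = (SOME q. q \<in> V \<and> (\<lambda>x. y x - q x) \<in> L2_orthogonal V)"

definition orthonormal_basis :: "('i \<Rightarrow> real \<Rightarrow> complex) \<Rightarrow> bool" where
  "orthonormal_basis u \<longleftrightarrow> (\<forall>i. u i \<in> L2) \<and>
     (\<forall>i j. L2_inner (u i) (u j) = (if i = j then 1 else 0)) \<and>
     (\<forall>f\<in>L2. L2_has_sum (\<lambda>i x. L2_inner f (u i) * u i x) f)"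

definition frame_over ::
    "(real \<Rightarrow> complex) set \<Rightarrow> ('i \<Rightarrow> real \<Rightarrow> complex) \<Rightarrow> real \<Rightarrow> real \<Rightarrow> bool" where
  "frame_over V f A B \<longleftrightarrow> 0 < A \<and> 0 < B \<and> (\<forall>i. f i \<in> V) \<and>
     (\<forall>z\<in>V. (\<lambda>i. (cmod (L2_inner z (f i)))\<^sup>2) summable_on UNIV \<and>
        A * (L2_norm z)\<^sup>2 \<le> (\<Sum>\<^sub>\<infinity>i. (cmod (L2_inner z (f i)))\<^sup>2) \<and>
        (\<Sum>\<^sub>\<infinity>i. (cmod (L2_inner z (f i)))\<^sup>2) \<le> B * (L2_norm z)\<^sup>2)"

text \<open>The last clause says that the adjoint of \<^term>\<open>K\<close> maps \<^term>\<open>v i\<close> to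
  \<^term>\<open>\<kappa> i\<close> times \<^term>\<open>u i\<close>.\<close>

definition diagonal_frame_decomposition ::
    "((real \<Rightarrow> complex) \<Rightarrow> (real \<Rightarrow> complex)) \<Rightarrow> ('i \<Rightarrow> real \<Rightarrow> complex) \<Rightarrow>
     ('i \<Rightarrow> real \<Rightarrow> complex) \<Rightarrow> ('i \<Rightarrow> real) \<Rightarrow> bool" where
  "diagonal_frame_decomposition K u v \<kappa> \<longleftrightarrow>
     (\<exists>A B. frame_over (L2_orthogonal (L2_kernel K)) u A B) \<and>
     (\<exists>A B. frame_over (L2_closed_range K) v A B) \<and>
     (\<forall>i. \<forall>f\<in>L2. L2_inner (K f) (v i) = L2_inner f (\<lambda>x. complex_of_real (\<kappa> i) * u i x))"

definition wavelet :: "(real \<Rightarrow> complex) \<Rightarrow> int \<times> int \<Rightarrow> real \<Rightarrow> complex" where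
  "wavelet \<psi> l x = complex_of_real (2 powr (of_int (fst l) / 2)) *
     \<psi> (2 powr (of_int (fst l)) * x - of_int (snd l))"

definition wavelet_kappa :: "int \<times> int \<Rightarrow> real" where
  "wavelet_kappa l = (if fst l \<ge> 1 then 2 powr (- 2 * of_int (fst l)) else 1)"

definition source_set ::
    "('i \<Rightarrow> real \<Rightarrow> complex) \<Rightarrow> ('i \<Rightarrow> real) \<Rightarrow> (real \<Rightarrow> real) \<Rightarrow> real \<Rightarrow> (real \<Rightarrow> complex) set" where
  "source_set u \<kappa> \<phi> E = {\<theta> \<in> L2.
     (\<lambda>i. inverse (\<phi> ((\<kappa> i)\<^sup>2)) * (cmod (L2_inner \<theta> (u i)))\<^sup>2) summable_on UNIV \<and>
     (\<Sum>\<^sub>\<infinity>i. inverse (\<phi> ((\<kappa> i)\<^sup>2)) * (cmod (L2_inner \<theta> (u i)))\<^sup>2) \<le> E\<^sup>2}"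

definition regularized ::
    "('i \<Rightarrow> real \<Rightarrow> complex) \<Rightarrow> ('i \<Rightarrow> real \<Rightarrow> complex) \<Rightarrow> ('i \<Rightarrow> real) \<Rightarrow> real \<Rightarrow>
     (real \<Rightarrow> complex) \<Rightarrow> (real \<Rightarrow> complex)" where
  "regularized u v \<kappa> \<alpha> y =
     L2_suminf (\<lambda>i x. complex_of_real (\<kappa> i / (\<alpha> + (\<kappa> i)\<^sup>2)) * L2_inner y (v i) * u i x)"

definition morozov_equation ::
    "((real \<Rightarrow> complex) \<Rightarrow> (real \<Rightarrow> complex)) \<Rightarrow> ('i \<Rightarrow> real \<Rightarrow> complex) \<Rightarrow>
     ('i \<Rightarrow> real \<Rightarrow> complex) \<Rightarrow> ('i \<Rightarrow> real) \<Rightarrow> real \<Rightarrow> real \<Rightarrow> real \<Rightarrow> (real \<Rightarrow> complex) \<Rightarrow> real \<Rightarrow> bool"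
  where
  "morozov_equation K u v \<kappa> B \<tau> \<delta> y \<alpha> \<longleftrightarrow>
     (let r = (\<lambda>x. K (regularized u v \<kappa> \<alpha> y) x - y x) in
        (\<lambda>i. (cmod (L2_inner r (v i)))\<^sup>2) summable_on UNIV \<and>
        sqrt (\<Sum>\<^sub>\<infinity>i. (cmod (L2_inner r (v i)))\<^sup>2) = \<tau> * sqrt B * \<delta>)"

definition morozov_solvable ::
    "((real \<Rightarrow> complex) \<Rightarrow> (real \<Rightarrow> complex)) \<Rightarrow> real \<Rightarrow> real \<Rightarrow> real \<Rightarrow> real \<Rightarrow> (real \<Rightarrow> complex) set" where
  "morozov_solvable K A B \<tau> \<delta> = {y \<in> L2. 0 < \<tau> * sqrt B * \<delta> \<and>
     \<tau> * sqrt B * \<delta> < sqrt A * L2_norm (L2_proj (L2_closed_range K) y)}"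

text \<open>Worst-case error with the data restricted to \<^term>\<open>D\<close>; the classical worst-case error is
  the case where \<^term>\<open>D\<close> is all of \<^term>\<open>L2\<close>.\<close>

definition worst_case_error ::
    "((real \<Rightarrow> complex) \<Rightarrow> (real \<Rightarrow> complex)) \<Rightarrow> (real \<Rightarrow> complex) set \<Rightarrow> (real \<Rightarrow> complex) set \<Rightarrow>
     real \<Rightarrow> ((real \<Rightarrow> complex) \<Rightarrow> (real \<Rightarrow> complex)) \<Rightarrow> ennreal" where
  "worst_case_error K D M \<delta> R =
     (SUP (x, y) \<in> {(x, y). x \<in> M \<and> y \<in> D \<and> L2_norm (\<lambda>t. K x t - y t) \<le> \<delta>}.
        ennreal (L2_norm (\<lambda>t. R y t - x t)))"

text \<open>A method assigns to each noise level \<^term>\<open>\<delta>\<close> a reconstruction map on the admissible data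
  \<^term>\<open>D \<delta>\<close>; it is compared with all maps on the whole of L2.\<close>

definition uniform_order_optimal ::
    "((real \<Rightarrow> complex) \<Rightarrow> (real \<Rightarrow> complex)) \<Rightarrow> (real \<Rightarrow> (real \<Rightarrow> complex) set) \<Rightarrow>
     (real \<Rightarrow> complex) set \<Rightarrow> (real \<Rightarrow> (real \<Rightarrow> complex) \<Rightarrow> (real \<Rightarrow> complex)) \<Rightarrow> bool" where
  "uniform_order_optimal K D M R \<longleftrightarrow>
     (\<exists>\<delta>0>0. \<exists>c>0. \<forall>\<delta>. 0 < \<delta> \<and> \<delta> < \<delta>0 \<longrightarrow>
        (\<forall>y\<in>D \<delta>. R \<delta> y \<in> L2) \<and>
        worst_case_error K (D \<delta>) M \<delta> (R \<delta>) \<le>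
          ennreal c * (INF S\<in>{S. L2_map S}. worst_case_error K L2 M \<delta> S))"

end

theory Submission
  imports Defs "HOL-Probability.Levy"
begin

text \<open>
  In the coordinates \<open>x i = \<langle>x, u i\<rangle>\<close> of the orthonormal basis and \<open>y i = \<langle>y, v i\<rangle>\<close> of the frame, the
  operator becomes multiplication by \<open>\<kappa> i\<close>, because \<open>\<langle>K x, v i\<rangle> = \<kappa> i * \<langle>x, u i\<rangle>\<close>. The regularized
  solution has the coordinates \<open>\<kappa> i / (\<alpha> + (\<kappa> i)\<^sup>2) * y i\<close>, and its error splits into the filtered noise
  and the bias \<open>\<alpha> / (\<alpha> + (\<kappa> i)\<^sup>2) * x i\<close>. By Parseval's identity everything is an estimate for
  square-summable families of coordinates.

  Put \<open>\<mu> = (\<delta> / E) powr (2 / (p + 2))\<close>. This is the singular value at which the noise \<open>\<delta> / \<mu>\<close> and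
  the smoothness term \<open>\<mu> powr (p / 2) * E\<close> coincide, and their common value \<open>\<rho>\<close> is the claimed rate
  (\<open>balance_scale\<close>).

  \<^item> A priori choice (\<open>apriori_error\<close>): \<open>\<alpha> = \<mu>\<^sup>2\<close>. The noise is amplified by at most \<open>1 / \<mu>\<close>, and the
    filter inequality \<open>\<alpha> * \<kappa> powr s \<le> \<alpha> powr (s / 2) * (\<alpha> + \<kappa>\<^sup>2)\<close>, valid for \<open>0 \<le> s \<le> 2\<close>, bounds the bias
    by \<open>\<mu> powr (p / 2) * E\<close>.

  \<^item> Morozov's choice (\<open>morozov_error\<close>): the coordinates of the residual are
    \<open>\<alpha> / (\<alpha> + (\<kappa> i)\<^sup>2) * y i\<close> up to sign. Since \<open>\<tau> > 1\<close>, a residual of size \<open>\<tau> * sqrt B * \<delta>\<close> cannot be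
    due to noise alone, which bounds \<open>\<alpha>\<close> from below (\<open>morozov_parameter_lower\<close>) and hence the amplified
    noise from above. The same equation bounds the bias weighted by \<open>\<kappa> i\<close>, the source condition bounds it
    weighted by \<open>\<kappa> i powr (- p / 2)\<close>, and interpolation between the two weights gives the rate.

  \<^item> Optimality (\<open>worst_case_error_lower\<close>): for an index with \<open>\<kappa> i\<close> within a factor 4 of \<open>\<mu>\<close>, the two
    opposite multiples of \<open>u i\<close> of norm comparable to \<open>\<rho>\<close> both lie in the source set and are both
    compatible with the data \<open>0\<close>, so no map can be closer than that norm to both.

  The frame inequality is a statement about the closed range of \<open>K\<close>, whereas the data are arbitrary
  square-integrable functions. The upper bound passes to all of \<^const>\<open>L2\<close> by duality once the
  closed range is a linear space (\<open>frame_Bessel\<close>). The operator is characterised only through Fourier transforms, so its linearity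
  up to null sets rests on the injectivity of the Fourier transform (\<open>L2_fourier_injective\<close>), which is
  reduced to the uniqueness theorem for characteristic functions of probability distributions. The series
  defining the regularized solution converges by the Riesz-Fischer theorem.
\<close>

section \<open>The space of square-integrable functions\<close>

lemma L2_measurable: "f \<in> L2 \<Longrightarrow> f \<in> borel_measurable lborel"
  by (simp add: L2_def)

lemma L2_square_integrable: "f \<in> L2 \<Longrightarrow> integrable lborel (\<lambda>x. (cmod (f x))\<^sup>2)"
  by (simp add: L2_def)

lemma L2_lincomb:
  assumes "f \<in> L2" "g \<in> L2"
  shows "(\<lambda>x. a * f x + b * g x) \<in> L2"
proof -
  note [measurable] = assms[THEN L2_measurable]
  have "integrable lborel (\<lambda>x. (cmod (a * f x + b * g x))\<^sup>2)"
  proof (rule Bochner_Integration.integrable_bound)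
    show "integrable lborel
        (\<lambda>x. 2 * (cmod a)\<^sup>2 * (cmod (f x))\<^sup>2 + 2 * (cmod b)\<^sup>2 * (cmod (g x))\<^sup>2)"
      using assms[THEN L2_square_integrable] by simp
    have "(cmod (a * f x + b * g x))\<^sup>2
        \<le> 2 * (cmod a)\<^sup>2 * (cmod (f x))\<^sup>2 + 2 * (cmod b)\<^sup>2 * (cmod (g x))\<^sup>2" for x
    proof -
      have "(cmod (a * f x + b * g x))\<^sup>2 \<le> (cmod a * cmod (f x) + cmod b * cmod (g x))\<^sup>2"
        by (metis norm_ge_zero norm_mult norm_triangle_ineq power_mono)
      also have "\<dots> \<le> 2 * (cmod a * cmod (f x))\<^sup>2 + 2 * (cmod b * cmod (g x))\<^sup>2"
        using sum_squares_bound[of "cmod a * cmod (f x)" "cmod b * cmod (g x)"]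
        by (simp add: power2_sum)
      finally show ?thesis by (simp add: power_mult_distrib)
    qed
    then show "AE x in lborel. norm ((cmod (a * f x + b * g x))\<^sup>2)
        \<le> norm (2 * (cmod a)\<^sup>2 * (cmod (f x))\<^sup>2 + 2 * (cmod b)\<^sup>2 * (cmod (g x))\<^sup>2)"
      by (auto simp: abs_of_nonneg)
  qed measurable
  then show ?thesis by (simp add: L2_def)
qed

lemma L2_zero: "(\<lambda>x. 0) \<in> L2"
  by (simp add: L2_def)

lemma L2_add: "f \<in> L2 \<Longrightarrow> g \<in> L2 \<Longrightarrow> (\<lambda>x. f x + g x) \<in> L2"
  using L2_lincomb[of f g 1 1] by simp

lemma L2_diff: "f \<in> L2 \<Longrightarrow> g \<in> L2 \<Longrightarrow> (\<lambda>x. f x - g x) \<in> L2"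
  using L2_lincomb[of f g 1 "-1"] by simp

lemma L2_scale: "f \<in> L2 \<Longrightarrow> (\<lambda>x. a * f x) \<in> L2"
  using L2_lincomb[of f f a 0] by simp

lemma L2_sum:
  assumes "finite J" "\<And>i. i \<in> J \<Longrightarrow> f i \<in> L2"
  shows "(\<lambda>x. \<Sum>i\<in>J. f i x) \<in> L2"
  using assms by (induction J rule: finite_induct) (auto intro: L2_zero L2_add)

lemma L2_norm_nonneg: "0 \<le> L2_norm f"
  by (simp add: L2_norm_def)

lemma L2_norm_power2: "(L2_norm f)\<^sup>2 = (LINT x|lborel. (cmod (f x))\<^sup>2)"
  by (simp add: L2_norm_def)

lemma L2_norm_cong_AE:
  assumes "f \<in> borel_measurable lborel" "g \<in> borel_measurable lborel" "AE x in lborel. f x = g x"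
  shows "L2_norm f = L2_norm g"
proof -
  have "(LINT x|lborel. (cmod (f x))\<^sup>2) = (LINT x|lborel. (cmod (g x))\<^sup>2)"
    using assms by (intro integral_cong_AE) auto
  then show ?thesis by (simp add: L2_norm_def)
qed

lemma L2_norm_scale: "L2_norm (\<lambda>x. a * f x) = cmod a * L2_norm f"
  by (simp add: L2_norm_def norm_mult power_mult_distrib real_sqrt_mult)

lemma L2_norm_uminus: "L2_norm (\<lambda>x. - f x) = L2_norm f"
  by (simp add: L2_norm_def)

lemma L2_norm_minus_commute: "L2_norm (\<lambda>x. f x - g x) = L2_norm (\<lambda>x. g x - f x)"
  by (simp add: L2_norm_def norm_minus_commute)

lemma L2_nn_integral:
  assumes "f \<in> L2"
  shows "(\<integral>\<^sup>+ x. ennreal ((cmod (f x))\<^sup>2) \<partial>lborel) = ennreal ((L2_norm f)\<^sup>2)"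
  unfolding L2_norm_power2 using L2_square_integrable[OF assms]
  by (intro nn_integral_eq_integral) auto

lemma L2_I:
  assumes "f \<in> borel_measurable lborel"
    and "(\<integral>\<^sup>+ x. ennreal ((cmod (f x))\<^sup>2) \<partial>lborel) < \<infinity>"
  shows "f \<in> L2"
  using assms by (auto simp: L2_def integrable_iff_bounded)

lemma L2_norm_eq_0_AE:
  assumes "f \<in> L2" "L2_norm f = 0"
  shows "AE x in lborel. f x = 0"
proof -
  note [measurable] = L2_measurable[OF assms(1)]
  have "(\<integral>\<^sup>+ x. ennreal ((cmod (f x))\<^sup>2) \<partial>lborel) = 0"
    using L2_nn_integral[OF assms(1)] assms(2) by simp
  then show ?thesis by (subst (asm) nn_integral_0_iff_AE) auto
qed

lemma power2_le_imp_le_ennreal: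
  fixes a b :: ennreal
  assumes "a\<^sup>2 \<le> b\<^sup>2"
  shows "a \<le> b"
proof (rule ccontr)
  assume "\<not> a \<le> b"
  then have "b < a" by simp
  have "b * b < a * a"
  proof (cases "b = 0")
    case True
    with \<open>b < a\<close> show ?thesis by (simp add: ennreal_zero_less_mult_iff)
  next
    case False
    have "b < top" using \<open>b < a\<close> top.not_eq_extremum by fastforce
    then have "b * b < b * a"
      using False \<open>b < a\<close> by (intro ennreal_mult_strict_left_mono) (auto simp: zero_less_iff_neq_zero)
    also have "\<dots> \<le> a * a" using \<open>b < a\<close> by (intro mult_right_mono) auto
    finally show ?thesis .
  qed
  with assms show False by (simp add: power2_eq_square)
qed

text \<open>Bounding the nonnegative integral of the absolute values gives both the integrability of the
  product and the bound for the inner product.\<close>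

lemma L2_Cauchy_Schwarz_nn:
  assumes "f \<in> L2" "g \<in> L2"
  shows "(\<integral>\<^sup>+ x. ennreal (cmod (f x * g x)) \<partial>lborel) \<le> ennreal (L2_norm f * L2_norm g)"
proof -
  note [measurable] = assms[THEN L2_measurable]
  have "(\<integral>\<^sup>+ x. ennreal (cmod (f x * g x)) \<partial>lborel)\<^sup>2
      = (\<integral>\<^sup>+ x. ennreal (cmod (f x)) * ennreal (cmod (g x)) \<partial>lborel)\<^sup>2"
    by (simp add: norm_mult ennreal_mult')
  also have "\<dots> \<le> (\<integral>\<^sup>+ x. (ennreal (cmod (f x)))\<^sup>2 \<partial>lborel) * (\<integral>\<^sup>+ x. (ennreal (cmod (g x)))\<^sup>2 \<partial>lborel)"
    by (intro Cauchy_Schwarz_nn_integral) measurable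
  also have "\<dots> = (ennreal (L2_norm f * L2_norm g))\<^sup>2"
    using L2_nn_integral[OF assms(1)] L2_nn_integral[OF assms(2)]
    by (simp add: ennreal_power power_mult_distrib ennreal_mult' L2_norm_nonneg)
  finally show ?thesis by (rule power2_le_imp_le_ennreal)
qed

lemma L2_mult_integrable:
  assumes "f \<in> L2" "g \<in> L2"
  shows "integrable lborel (\<lambda>x. f x * g x)"
proof -
  note [measurable] = assms[THEN L2_measurable]
  show ?thesis
    using L2_Cauchy_Schwarz_nn[OF assms]
    by (auto simp: integrable_iff_bounded intro: le_less_trans)
qed

lemma L2_cnj: "f \<in> L2 \<Longrightarrow> (\<lambda>x. cnj (f x)) \<in> L2"
  using measurable_compose[of f lborel borel cnj borel]
    borel_measurable_continuous_onI[OF continuous_on_cnj[OF continuous_on_id]]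
  by (simp add: L2_def)

lemma L2_norm_cnj: "L2_norm (\<lambda>x. cnj (f x)) = L2_norm f"
  by (simp add: L2_norm_def)

lemma L2_Cauchy_Schwarz_integral:
  assumes "f \<in> L2" "g \<in> L2"
  shows "cmod (LINT x|lborel. f x * g x) \<le> L2_norm f * L2_norm g"
proof -
  have "ennreal (cmod (LINT x|lborel. f x * g x)) \<le> (\<integral>\<^sup>+ x. ennreal (cmod (f x * g x)) \<partial>lborel)"
    using L2_mult_integrable[OF assms] by (rule integral_norm_bound_ennreal)
  also have "\<dots> \<le> ennreal (L2_norm f * L2_norm g)"
    by (rule L2_Cauchy_Schwarz_nn[OF assms])
  finally show ?thesis by (simp add: L2_norm_nonneg)
qed

lemma L2_Cauchy_Schwarz:
  assumes "f \<in> L2" "g \<in> L2"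
  shows "cmod (L2_inner f g) \<le> L2_norm f * L2_norm g"
  using L2_Cauchy_Schwarz_integral[OF assms(1) L2_cnj[OF assms(2)]]
  by (simp add: L2_inner_def L2_norm_cnj)

lemma L2_inner_cnj: "L2_inner g f = cnj (L2_inner f g)"
  using Bochner_Integration.integral_cnj[of lborel "\<lambda>x. f x * cnj (g x)"] by (simp add: L2_inner_def mult.commute)

lemma L2_inner_lincomb_left:
  assumes "f \<in> L2" "g \<in> L2" "k \<in> L2"
  shows "L2_inner (\<lambda>x. a * f x + b * g x) k = a * L2_inner f k + b * L2_inner g k"
  using L2_mult_integrable[OF assms(1) L2_cnj[OF assms(3)]]
    L2_mult_integrable[OF assms(2) L2_cnj[OF assms(3)]]
  by (simp add: L2_inner_def distrib_right mult.assoc)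

lemma L2_inner_add_left:
  "f \<in> L2 \<Longrightarrow> g \<in> L2 \<Longrightarrow> k \<in> L2 \<Longrightarrow> L2_inner (\<lambda>x. f x + g x) k = L2_inner f k + L2_inner g k"
  using L2_inner_lincomb_left[of f g k 1 1] by simp

lemma L2_inner_diff_left:
  "f \<in> L2 \<Longrightarrow> g \<in> L2 \<Longrightarrow> k \<in> L2 \<Longrightarrow> L2_inner (\<lambda>x. f x - g x) k = L2_inner f k - L2_inner g k"
  using L2_inner_lincomb_left[of f g k 1 "-1"] by simp

lemma L2_inner_scale_left: "L2_inner (\<lambda>x. a * f x) k = a * L2_inner f k"
  by (simp add: L2_inner_def mult.assoc)

lemma L2_inner_scale_right: "L2_inner k (\<lambda>x. a * f x) = cnj a * L2_inner k f"
  by (simp add: L2_inner_def mult.left_commute)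

lemma L2_inner_zero_left: "L2_inner (\<lambda>x. 0) k = 0"
  by (simp add: L2_inner_def)

lemma L2_inner_sum_left:
  assumes "finite J" "\<And>i. i \<in> J \<Longrightarrow> f i \<in> L2" "k \<in> L2"
  shows "L2_inner (\<lambda>x. \<Sum>i\<in>J. f i x) k = (\<Sum>i\<in>J. L2_inner (f i) k)"
  using assms
  by (induction J rule: finite_induct) (auto simp: L2_inner_zero_left L2_inner_add_left L2_sum)

lemma L2_inner_sum_right:
  assumes "finite J" "\<And>i. i \<in> J \<Longrightarrow> f i \<in> L2" "k \<in> L2"
  shows "L2_inner k (\<lambda>x. \<Sum>i\<in>J. f i x) = (\<Sum>i\<in>J. L2_inner k (f i))"
  by (subst (1 2) L2_inner_cnj) (simp add: L2_inner_sum_left assms cnj_sum)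

lemma L2_inner_self: "L2_inner f f = complex_of_real ((L2_norm f)\<^sup>2)"
  unfolding L2_inner_def L2_norm_power2 integral_complex_of_real[symmetric]
  by (simp only: complex_norm_square)

lemma L2_norm_power2_add:
  assumes "f \<in> L2" "g \<in> L2"
  shows "(L2_norm (\<lambda>x. f x + g x))\<^sup>2 = (L2_norm f)\<^sup>2 + 2 * Re (L2_inner f g) + (L2_norm g)\<^sup>2"
proof -
  have "complex_of_real ((L2_norm (\<lambda>x. f x + g x))\<^sup>2) = L2_inner (\<lambda>x. f x + g x) (\<lambda>x. f x + g x)"
    by (rule L2_inner_self[symmetric])
  also have "\<dots> = L2_inner f (\<lambda>x. f x + g x) + L2_inner g (\<lambda>x. f x + g x)"
    by (intro L2_inner_add_left assms L2_add)
  also have "\<dots> = cnj (L2_inner (\<lambda>x. f x + g x) f) + cnj (L2_inner (\<lambda>x. f x + g x) g)"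
    by (simp flip: L2_inner_cnj)
  also have "\<dots> = L2_inner f f + cnj (L2_inner g f) + cnj (L2_inner f g) + L2_inner g g"
    using assms by (simp add: L2_inner_add_left L2_inner_self)
  also have "\<dots> = complex_of_real ((L2_norm f)\<^sup>2 + 2 * Re (L2_inner f g) + (L2_norm g)\<^sup>2)"
    using complex_add_cnj[of "L2_inner f g"] by (simp add: L2_inner_self flip: L2_inner_cnj)
  finally show ?thesis using of_real_eq_iff by blast
qed

lemma L2_norm_triangle:
  assumes "f \<in> L2" "g \<in> L2"
  shows "L2_norm (\<lambda>x. f x + g x) \<le> L2_norm f + L2_norm g"
proof (rule power2_le_imp_le)
  have "Re (L2_inner f g) \<le> L2_norm f * L2_norm g"
    using L2_Cauchy_Schwarz[OF assms] complex_Re_le_cmod order_trans by blast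
  then show "(L2_norm (\<lambda>x. f x + g x))\<^sup>2 \<le> (L2_norm f + L2_norm g)\<^sup>2"
    by (simp add: L2_norm_power2_add[OF assms] power2_sum)
qed (simp add: L2_norm_nonneg)

lemma L2_norm_diff_triangle:
  assumes "f \<in> L2" "g \<in> L2" "k \<in> L2"
  shows "L2_norm (\<lambda>x. f x - k x) \<le> L2_norm (\<lambda>x. f x - g x) + L2_norm (\<lambda>x. g x - k x)"
  using L2_norm_triangle[OF L2_diff[OF assms(1,2)] L2_diff[OF assms(2,3)]] by simp

lemma L2_tendsto_iff_norm:
  assumes "eventually (\<lambda>i. f i \<in> L2) F" "g \<in> L2"
  shows "L2_tendsto f g F \<longleftrightarrow> ((\<lambda>i. L2_norm (\<lambda>x. f i x - g x)) \<longlongrightarrow> 0) F"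
proof -
  have "L2_tendsto f g F \<longleftrightarrow> ((\<lambda>i. ennreal ((L2_norm (\<lambda>x. f i x - g x))\<^sup>2)) \<longlongrightarrow> ennreal 0) F"
    unfolding L2_tendsto_def ennreal_0
    by (rule tendsto_cong, rule eventually_mono[OF assms(1)]) (simp add: L2_nn_integral L2_diff assms(2))
  also have "\<dots> \<longleftrightarrow> ((\<lambda>i. (L2_norm (\<lambda>x. f i x - g x))\<^sup>2) \<longlongrightarrow> 0) F"
    by (rule tendsto_ennreal_iff) auto
  also have "\<dots> \<longleftrightarrow> ((\<lambda>i. L2_norm (\<lambda>x. f i x - g x)) \<longlongrightarrow> 0) F"
    using tendsto_power_strong tendsto_real_sqrt[of "\<lambda>i. (L2_norm (\<lambda>x. f i x - g x))\<^sup>2" 0 F]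
      tendsto_power[of "\<lambda>i. L2_norm (\<lambda>x. f i x - g x)" 0 F 2]
    by (auto simp: L2_norm_nonneg)
  finally show ?thesis .
qed

section \<open>Completeness and orthonormal bases\<close>

text \<open>Riesz-Fischer for rapidly converging sequences. With geometric weights the increments
  satisfy \<open>\<Sum>n. 2 ^ n * |s (n+1) - s n|\<^sup>2 < \<infinity>\<close> almost everywhere, so the increments decay
  geometrically at almost every point and the sequence converges there. The rate survives in the
  limit by Fatou's lemma.\<close>

lemma L2_complete_fast:
  assumes s: "\<And>n. s n \<in> L2" and d: "\<And>m n. n \<le> m \<Longrightarrow> L2_norm (\<lambda>x. s m x - s n x) \<le> (1/2) ^ n"
  obtains l where "l \<in> L2" "\<And>n. L2_norm (\<lambda>x. s n x - l x) \<le> (1/2) ^ n"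
proof -
  note [measurable] = s[THEN L2_measurable]
  define D where "D n x = s (Suc n) x - s n x" for n x
  have [measurable]: "D n \<in> borel_measurable lborel" for n unfolding D_def by measurable
  have DL: "D n \<in> L2" for n unfolding D_def by (intro L2_diff s)
  have "(\<integral>\<^sup>+ x. (\<Sum>n. ennreal (2 ^ n * (cmod (D n x))\<^sup>2)) \<partial>lborel)
      = (\<Sum>n. \<integral>\<^sup>+ x. ennreal (2 ^ n * (cmod (D n x))\<^sup>2) \<partial>lborel)"
    by (rule nn_integral_suminf) measurable
  also have "\<dots> = (\<Sum>n. ennreal (2 ^ n * (L2_norm (D n))\<^sup>2))"
    by (simp add: ennreal_mult' nn_integral_cmult L2_nn_integral[OF DL])
  also have "\<dots> \<le> (\<Sum>n. ennreal ((1/2) ^ n))"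
  proof (intro suminf_le ennreal_leI)
    fix n
    have "(L2_norm (D n))\<^sup>2 \<le> ((1/2) ^ n)\<^sup>2"
      unfolding D_def by (intro power_mono d L2_norm_nonneg) simp
    then have "2 ^ n * (L2_norm (D n))\<^sup>2 \<le> 2 ^ n * ((1/2) ^ n)\<^sup>2"
      by (intro mult_left_mono) auto
    also have "\<dots> = (1/2) ^ n"
      by (simp add: power2_eq_square flip: power_mult_distrib mult.assoc)
    finally show "2 ^ n * (L2_norm (D n))\<^sup>2 \<le> (1/2) ^ n" .
  qed auto
  also have "\<dots> < \<infinity>"
    by (simp add: suminf_ennreal_eq[OF _ geometric_sums])
  finally have "(\<integral>\<^sup>+ x. (\<Sum>n. ennreal (2 ^ n * (cmod (D n x))\<^sup>2)) \<partial>lborel) \<noteq> \<infinity>" by simp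
  then have fin: "AE x in lborel. (\<Sum>n. ennreal (2 ^ n * (cmod (D n x))\<^sup>2)) \<noteq> \<infinity>"
    by (intro nn_integral_PInf_AE) measurable
  have conv: "convergent (\<lambda>n. s n x)" if *: "(\<Sum>n. ennreal (2 ^ n * (cmod (D n x))\<^sup>2)) \<noteq> \<infinity>" for x
  proof -
    have "\<exists>S\<ge>0. X = ennreal S" if "X \<noteq> \<infinity>" for X :: ennreal
      using that by (cases X) auto
    from this[OF *] obtain S where S: "0 \<le> S" "(\<Sum>n. ennreal (2 ^ n * (cmod (D n x))\<^sup>2)) = ennreal S"
      by blast
    have bd: "cmod (D n x) \<le> sqrt S * (1 / sqrt 2) ^ n" for n
    proof -
      have "ennreal (2 ^ n * (cmod (D n x))\<^sup>2) \<le> ennreal S"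
        unfolding S(2)[symmetric] using sum_le_suminf[of _ "{n}"] by (intro sum_le_suminf[of _ "{n}", simplified]) auto
      then have "2 ^ n * (cmod (D n x))\<^sup>2 \<le> S" using S(1) by simp
      then have "(cmod (D n x))\<^sup>2 \<le> S / 2 ^ n" by (simp add: field_simps)
      then have "cmod (D n x) \<le> sqrt (S / 2 ^ n)" by (rule real_le_rsqrt)
      also have "\<dots> = sqrt S * (1 / sqrt 2) ^ n"
        by (simp add: real_sqrt_divide real_sqrt_power power_divide)
      finally show ?thesis .
    qed
    have "summable (\<lambda>n. sqrt S * (1 / sqrt 2) ^ n)"
      by (intro summable_mult summable_geometric) simp
    then have "summable (\<lambda>n. D n x)"
      by (rule summable_comparison_test'[where N = 0]) (rule bd)
    then have "convergent (\<lambda>n. \<Sum>i<n. D i x)"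
      by (simp add: summable_iff_convergent)
    moreover have "(\<lambda>n. \<Sum>i<n. D i x) = (\<lambda>n. s n x - s 0 x)"
      using sum_lessThan_telescope[of "\<lambda>n. s n x"] by (simp add: D_def)
    ultimately have "convergent (\<lambda>n. (s n x - s 0 x) + s 0 x)"
      by (intro convergent_add convergent_const) simp
    then show ?thesis by simp
  qed
  define l where "l x = lim (\<lambda>n. s n x)" for x
  have [measurable]: "l \<in> borel_measurable lborel" unfolding l_def by measurable
  have lim: "AE x in lborel. (\<lambda>n. s n x) \<longlonglongrightarrow> l x"
    using fin by eventually_elim (simp only: l_def convergent_LIMSEQ_iff[symmetric], rule conv)
  have le: "(\<integral>\<^sup>+ x. ennreal ((cmod (s n x - l x))\<^sup>2) \<partial>lborel) \<le> ennreal (((1/2) ^ n)\<^sup>2)" for n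
  proof -
    have "(\<integral>\<^sup>+ x. ennreal ((cmod (s n x - l x))\<^sup>2) \<partial>lborel)
        = (\<integral>\<^sup>+ x. liminf (\<lambda>m. ennreal ((cmod (s m x - s n x))\<^sup>2)) \<partial>lborel)"
    proof (rule nn_integral_cong_AE, use lim in eventually_elim)
      case (elim x)
      have "(\<lambda>m. ennreal ((cmod (s m x - s n x))\<^sup>2)) \<longlonglongrightarrow> ennreal ((cmod (l x - s n x))\<^sup>2)"
        by (intro tendsto_intros elim)
      from lim_imp_Liminf[OF trivial_limit_sequentially this] show ?case
        by (simp only: norm_minus_commute[of "s n x"])
    qed
    also have "\<dots> \<le> liminf (\<lambda>m. \<integral>\<^sup>+ x. ennreal ((cmod (s m x - s n x))\<^sup>2) \<partial>lborel)"
      by (rule nn_integral_liminf) measurable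
    also have "\<dots> \<le> liminf (\<lambda>m. ennreal (((1/2) ^ n)\<^sup>2))"
    proof (rule Liminf_mono, rule eventually_sequentiallyI[of n])
      fix m assume "n \<le> m"
      then show "(\<integral>\<^sup>+ x. ennreal ((cmod (s m x - s n x))\<^sup>2) \<partial>lborel) \<le> ennreal (((1/2) ^ n)\<^sup>2)"
        unfolding L2_nn_integral[OF L2_diff[OF s s]]
        by (intro ennreal_leI power_mono d L2_norm_nonneg)
    qed
    also have "\<dots> = ennreal (((1/2) ^ n)\<^sup>2)" by (simp add: Liminf_const)
    finally show ?thesis .
  qed
  have dl: "(\<lambda>x. s n x - l x) \<in> L2" for n
    by (rule L2_I, measurable) (use le[of n] in \<open>auto intro: le_less_trans\<close>)
  have "l \<in> L2" using L2_diff[OF s dl, of 0 0] by simp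
  moreover have "L2_norm (\<lambda>x. s n x - l x) \<le> (1/2) ^ n" for n
    by (rule power2_le_imp_le) (use le[of n] in \<open>auto simp: L2_nn_integral[OF dl]\<close>)
  ultimately show thesis by (rule that)
qed

lemma orthonormal_basis_L2: "orthonormal_basis u \<Longrightarrow> u i \<in> L2"
  by (simp add: orthonormal_basis_def)

lemma orthonormal_basis_inner:
  "orthonormal_basis u \<Longrightarrow> L2_inner (u i) (u j) = (if i = j then 1 else 0)"
  by (simp add: orthonormal_basis_def)

lemma orthonormal_basis_L2_sum:
  "orthonormal_basis u \<Longrightarrow> finite J \<Longrightarrow> (\<lambda>x. \<Sum>i\<in>J. c i * u i x) \<in> L2"
  by (intro L2_sum L2_scale orthonormal_basis_L2)

lemma orthonormal_basis_norm_sum: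
  assumes u: "orthonormal_basis u" and J: "finite J"
  shows "(L2_norm (\<lambda>x. \<Sum>i\<in>J. c i * u i x))\<^sup>2 = (\<Sum>i\<in>J. (cmod (c i))\<^sup>2)"
proof -
  let ?s = "\<lambda>x. \<Sum>i\<in>J. c i * u i x"
  have L: "(\<lambda>x. c i * u i x) \<in> L2" for i
    by (intro L2_scale orthonormal_basis_L2 u)
  have *: "L2_inner (u i) ?s = cnj (c i)" if "i \<in> J" for i
    using J that
    by (subst L2_inner_sum_right[OF J L orthonormal_basis_L2[OF u]])
      (simp add: L2_inner_scale_right orthonormal_basis_inner[OF u] if_distrib cong: if_cong)
  have "complex_of_real ((L2_norm ?s)\<^sup>2) = (\<Sum>i\<in>J. L2_inner (\<lambda>x. c i * u i x) ?s)"
    unfolding L2_inner_self[symmetric]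
    by (intro L2_inner_sum_left J L orthonormal_basis_L2_sum u)
  also have "\<dots> = (\<Sum>i\<in>J. c i * cnj (c i))"
    by (intro sum.cong refl) (simp add: L2_inner_scale_left *)
  also have "\<dots> = complex_of_real (\<Sum>i\<in>J. (cmod (c i))\<^sup>2)"
    by (simp only: of_real_sum complex_norm_square)
  finally show ?thesis using of_real_eq_iff by blast
qed

lemma L2_has_sum_norm:
  assumes "L2_has_sum f s" "\<And>i. f i \<in> L2"
  shows "((\<lambda>J. L2_norm (\<lambda>x. (\<Sum>i\<in>J. f i x) - s x)) \<longlongrightarrow> 0) (finite_subsets_at_top UNIV)"
proof -
  have "\<forall>\<^sub>F J in finite_subsets_at_top UNIV. (\<lambda>x. \<Sum>i\<in>J. f i x) \<in> L2"
    by (intro eventually_finite_subsets_at_top_weakI L2_sum assms)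
  then show ?thesis
    using assms(1) by (auto simp: L2_has_sum_def L2_tendsto_iff_norm)
qed

lemma L2_has_sum_inner:
  assumes "L2_has_sum f s" "\<And>i. f i \<in> L2" "k \<in> L2"
  shows "((\<lambda>i. L2_inner (f i) k) has_sum L2_inner s k) UNIV"
proof -
  let ?F = "finite_subsets_at_top UNIV"
  have s: "s \<in> L2" using assms(1) by (simp add: L2_has_sum_def)
  have "((\<lambda>J. (\<Sum>i\<in>J. L2_inner (f i) k) - L2_inner s k) \<longlongrightarrow> 0) ?F"
  proof (rule Lim_null_comparison)
    show "((\<lambda>J. L2_norm (\<lambda>x. (\<Sum>i\<in>J. f i x) - s x) * L2_norm k) \<longlongrightarrow> 0) ?F"
      by (intro tendsto_mult_left_zero L2_has_sum_norm assms)
    show "\<forall>\<^sub>F J in ?F. norm ((\<Sum>i\<in>J. L2_inner (f i) k) - L2_inner s k)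
        \<le> L2_norm (\<lambda>x. (\<Sum>i\<in>J. f i x) - s x) * L2_norm k"
    proof (rule eventually_finite_subsets_at_top_weakI)
      fix J :: "'a set" assume J: "finite J"
      have SL: "(\<lambda>x. \<Sum>i\<in>J. f i x) \<in> L2" by (intro L2_sum J assms)
      have "(\<Sum>i\<in>J. L2_inner (f i) k) - L2_inner s k = L2_inner (\<lambda>x. (\<Sum>i\<in>J. f i x) - s x) k"
        by (simp add: L2_inner_diff_left[OF SL s assms(3)] L2_inner_sum_left[OF J assms(2,3)])
      then show "norm ((\<Sum>i\<in>J. L2_inner (f i) k) - L2_inner s k)
        \<le> L2_norm (\<lambda>x. (\<Sum>i\<in>J. f i x) - s x) * L2_norm k"
        using L2_Cauchy_Schwarz[OF L2_diff[OF SL s] assms(3)] by simp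
    qed
  qed
  then show ?thesis by (simp add: has_sum_def LIM_zero_iff)
qed

lemma L2_has_sum_coefficient:
  assumes u: "orthonormal_basis u" and s: "L2_has_sum (\<lambda>i x. c i * u i x) s"
  shows "L2_inner s (u j) = c j"
proof -
  have "((\<lambda>i. L2_inner (\<lambda>x. c i * u i x) (u j)) has_sum L2_inner s (u j)) UNIV"
    by (intro L2_has_sum_inner s L2_scale orthonormal_basis_L2 u)
  then have "((\<lambda>i. if i = j then c j else 0) has_sum L2_inner s (u j)) UNIV"
    by (simp add: L2_inner_scale_left orthonormal_basis_inner[OF u] if_distrib cong: if_cong)
  moreover have "((\<lambda>i. if i = j then c j else 0) has_sum c j) UNIV"
    using has_sum_finite[of "{j}" "\<lambda>i. if i = j then c j else 0"]
    by (subst has_sum_cong_neutral[where T = "{j}"]) auto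
  ultimately show ?thesis by (rule has_sum_unique)
qed

lemma Parseval:
  assumes u: "orthonormal_basis u" and f: "f \<in> L2"
  shows "((\<lambda>i. (cmod (L2_inner f (u i)))\<^sup>2) has_sum (L2_norm f)\<^sup>2) UNIV"
proof -
  let ?F = "finite_subsets_at_top UNIV"
  let ?s = "\<lambda>J x. \<Sum>i\<in>J. L2_inner f (u i) * u i x"
  have "L2_has_sum (\<lambda>i x. L2_inner f (u i) * u i x) f"
    using u f by (simp add: orthonormal_basis_def)
  then have lim: "((\<lambda>J. L2_norm (\<lambda>x. ?s J x - f x)) \<longlongrightarrow> 0) ?F"
    by (rule L2_has_sum_norm) (intro L2_scale orthonormal_basis_L2 u)
  have "((\<lambda>J. L2_norm (?s J) - L2_norm f) \<longlongrightarrow> 0) ?F"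
  proof (rule Lim_null_comparison[OF _ lim], rule eventually_finite_subsets_at_top_weakI)
    fix J :: "'a set" assume J: "finite J"
    note S = orthonormal_basis_L2_sum[OF u J, of "\<lambda>i. L2_inner f (u i)"]
    show "norm (L2_norm (?s J) - L2_norm f) \<le> L2_norm (\<lambda>x. ?s J x - f x)"
      using L2_norm_triangle[OF L2_diff[OF S f] f] L2_norm_triangle[OF L2_diff[OF f S] S]
        L2_norm_minus_commute[of f "?s J"]
      by simp
  qed
  then have "((\<lambda>J. (L2_norm (?s J))\<^sup>2) \<longlongrightarrow> (L2_norm f)\<^sup>2) ?F"
    by (intro tendsto_power) (simp add: LIM_zero_iff)
  then show ?thesis
    unfolding has_sum_def
    by (rule Lim_transform_eventually)
      (auto intro!: eventually_finite_subsets_at_top_weakI orthonormal_basis_norm_sum[OF u])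
qed

lemma L2_norm_le_coefficients:
  assumes u: "orthonormal_basis u" and f: "f \<in> L2" and "0 \<le> b"
    and "\<And>J. finite J \<Longrightarrow> L2_set (\<lambda>i. cmod (L2_inner f (u i))) J \<le> b"
  shows "L2_norm f \<le> b"
proof (rule power2_le_imp_le)
  have "(\<Sum>i\<in>J. (cmod (L2_inner f (u i)))\<^sup>2) \<le> b\<^sup>2" if "finite J" for J
    using power_mono[OF assms(4)[OF that] L2_set_nonneg, of 2]
    by (simp add: L2_set_def sum_nonneg)
  then show "(L2_norm f)\<^sup>2 \<le> b\<^sup>2"
    by (intro has_sum_le_finite_sums[OF Parseval[OF u f]])
qed fact

text \<open>Riesz-Fischer: nested finite index sets \<open>N n\<close> whose complements carry at most the
  mass \<open>4 ^ -n\<close> of the coefficients give rapidly converging partial sums, and every finite set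
  above \<open>N n\<close> gives a partial sum within \<open>2 ^ -n\<close> of the one over \<open>N n\<close>.\<close>

lemma Riesz_Fischer:
  assumes u: "orthonormal_basis u" and c: "(\<lambda>i. (cmod (c i))\<^sup>2) summable_on UNIV"
  shows "\<exists>s. L2_has_sum (\<lambda>i x. c i * u i x) s"
proof -
  let ?s = "\<lambda>J x. \<Sum>i\<in>J. c i * u i x"
  define S where "S = (\<Sum>\<^sub>\<infinity>i. (cmod (c i))\<^sup>2)"
  have lim: "((\<lambda>J. \<Sum>i\<in>J. (cmod (c i))\<^sup>2) \<longlongrightarrow> S) (finite_subsets_at_top UNIV)"
    using has_sum_infsum[OF c] by (simp add: has_sum_def S_def)
  have "\<exists>J. finite J \<and> S - ((1/2) ^ n)\<^sup>2 < (\<Sum>i\<in>J. (cmod (c i))\<^sup>2)" for n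
    using order_tendstoD(1)[OF lim, of "S - ((1/2) ^ n)\<^sup>2"]
    by (auto simp: eventually_finite_subsets_at_top)
  then obtain M where M: "finite (M n)" "S - ((1/2) ^ n)\<^sup>2 < (\<Sum>i\<in>M n. (cmod (c i))\<^sup>2)" for n
    by metis
  define N where "N n = (\<Union>k\<le>n. M k)" for n
  have N: "finite (N n)" "M n \<subseteq> N n" for n by (auto simp: N_def M)
  have N_mono: "N n \<subseteq> N m" if "n \<le> m" for n m using that by (force simp: N_def)
  have tail: "L2_norm (\<lambda>x. ?s J x - ?s (N n) x) \<le> (1/2) ^ n" if J: "finite J" "N n \<subseteq> J" for J n
  proof (rule power2_le_imp_le)
    have "(L2_norm (\<lambda>x. ?s J x - ?s (N n) x))\<^sup>2 = (L2_norm (?s (J - N n)))\<^sup>2"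
      by (simp add: sum_diff J)
    also have "\<dots> = (\<Sum>i\<in>J - N n. (cmod (c i))\<^sup>2)"
      using J by (intro orthonormal_basis_norm_sum u) simp
    also have "\<dots> \<le> (\<Sum>i\<in>J - M n. (cmod (c i))\<^sup>2)"
      using J N(2) by (intro sum_mono2) auto
    also have "\<dots> = (\<Sum>i\<in>J. (cmod (c i))\<^sup>2) - (\<Sum>i\<in>M n. (cmod (c i))\<^sup>2)"
      using J N(2) by (intro sum_diff) blast+
    also have "(\<Sum>i\<in>J. (cmod (c i))\<^sup>2) \<le> S"
      unfolding S_def using c J by (intro finite_sum_le_infsum) auto
    finally show "(L2_norm (\<lambda>x. ?s J x - ?s (N n) x))\<^sup>2 \<le> ((1/2) ^ n)\<^sup>2"
      using M(2)[of n] by simp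
  qed simp
  obtain l where l: "l \<in> L2" "\<And>n. L2_norm (\<lambda>x. ?s (N n) x - l x) \<le> (1/2) ^ n"
    using L2_complete_fast[of "\<lambda>n. ?s (N n)"] tail[OF N(1) N_mono] orthonormal_basis_L2_sum[OF u N(1)]
    by blast
  have "((\<lambda>J. L2_norm (\<lambda>x. ?s J x - l x)) \<longlongrightarrow> 0) (finite_subsets_at_top UNIV)"
  proof (rule tendstoI)
    fix e :: real assume "0 < e"
    then obtain n where n: "(1/2) ^ n < e / 2"
      using real_arch_pow_inv[of "e/2" "1/2"] by auto
    have "L2_norm (\<lambda>x. ?s J x - l x) < e" if "finite J" "N n \<subseteq> J" for J
      using L2_norm_diff_triangle[OF orthonormal_basis_L2_sum[OF u that(1)]
          orthonormal_basis_L2_sum[OF u N(1)[of n]] l(1), of c c]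
        tail[OF that] l(2)[of n] n by linarith
    then show "\<forall>\<^sub>F J in finite_subsets_at_top UNIV. dist (L2_norm (\<lambda>x. ?s J x - l x)) 0 < e"
      using N(1)[of n] by (auto simp: eventually_finite_subsets_at_top L2_norm_nonneg)
  qed
  moreover have "\<forall>\<^sub>F J in finite_subsets_at_top UNIV. ?s J \<in> L2"
    by (intro eventually_finite_subsets_at_top_weakI orthonormal_basis_L2_sum u)
  ultimately have "L2_has_sum (\<lambda>i x. c i * u i x) l"
    using l(1) by (simp add: L2_has_sum_def L2_tendsto_iff_norm)
  then show ?thesis by blast
qed

lemma L2_suminf_orthonormal_basis:
  assumes u: "orthonormal_basis u" and c: "(\<lambda>i. (cmod (c i))\<^sup>2) summable_on UNIV"
  shows "L2_suminf (\<lambda>i x. c i * u i x) \<in> L2"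
    and "L2_inner (L2_suminf (\<lambda>i x. c i * u i x)) (u j) = c j"
proof -
  have *: "L2_has_sum (\<lambda>i x. c i * u i x) (L2_suminf (\<lambda>i x. c i * u i x))"
    unfolding L2_suminf_def using Riesz_Fischer[OF assms] by (rule someI_ex)
  then show "L2_suminf (\<lambda>i x. c i * u i x) \<in> L2" by (simp add: L2_has_sum_def)
  show "L2_inner (L2_suminf (\<lambda>i x. c i * u i x)) (u j) = c j"
    by (rule L2_has_sum_coefficient[OF u *])
qed

section \<open>Injectivity of the Fourier transform\<close>

text \<open>The positive and the negative part of \<open>D\<close> have the same Fourier transform, in particular the
  same total mass. Normalised by that mass they are densities of probability distributions with equal
  characteristic functions, so they agree by Levy's uniqueness theorem.\<close>

lemma integrable_real_Fourier_injective:
  fixes D :: "real \<Rightarrow> real"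
  assumes D: "integrable lborel D"
    and F: "\<And>a. (LINT t|lborel. D t *\<^sub>R iexp (a * t)) = 0"
  shows "AE t in lborel. D t = 0"
proof -
  define P Q where "P t = max (D t) 0" and "Q t = max (- D t) 0" for t
  have [measurable]: "D \<in> borel_measurable lborel" using D by auto
  have [measurable]: "P \<in> borel_measurable lborel" "Q \<in> borel_measurable lborel"
    unfolding P_def Q_def by measurable
  have PQ: "integrable lborel P" "integrable lborel Q"
    unfolding P_def Q_def using D by auto
  have nn: "0 \<le> P t" "0 \<le> Q t" for t by (auto simp: P_def Q_def)
  have DPQ: "D t = P t - Q t" for t by (auto simp: P_def Q_def)
  have int: "integrable lborel (\<lambda>t. R t *\<^sub>R iexp (a * t))" if "integrable lborel R" for R a
    using that by (rule Bochner_Integration.integrable_bound) (use that in auto)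
  have eq: "(LINT t|lborel. P t *\<^sub>R iexp (a * t)) = (LINT t|lborel. Q t *\<^sub>R iexp (a * t))" for a
    using F[of a] int[OF PQ(1), of a] int[OF PQ(2), of a] by (simp add: DPQ scaleR_diff_left)
  define m where "m = (LINT t|lborel. P t)"
  have mQ: "m = (LINT t|lborel. Q t)"
    using eq[of 0] by (simp add: m_def scaleR_conv_of_real)
  have m0: "0 \<le> m" unfolding m_def using nn by simp
  show ?thesis
  proof (cases "m = 0")
    case True
    then have "AE t in lborel. P t = 0" "AE t in lborel. Q t = 0"
      using integral_nonneg_eq_0_iff_AE[OF PQ(1)] integral_nonneg_eq_0_iff_AE[OF PQ(2)] nn mQ
      by (simp_all add: m_def)
    then show ?thesis by eventually_elim (simp add: DPQ)
  next
    case False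
    with m0 have m: "0 < m" by simp
    have dist: "real_distribution (density lborel (\<lambda>t. ennreal (R t / m)))"
      if [measurable]: "R \<in> borel_measurable lborel" and R: "integrable lborel R" "\<And>t. 0 \<le> R t"
        "m = (LINT t|lborel. R t)" for R
    proof -
      have "emeasure (density lborel (\<lambda>t. ennreal (R t / m))) (space (density lborel (\<lambda>t. ennreal (R t / m))))
          = (\<integral>\<^sup>+ t. ennreal (R t / m) \<partial>lborel)"
        by (subst emeasure_density) auto
      also have "\<dots> = ennreal (LINT t|lborel. R t / m)"
        using R m by (intro nn_integral_eq_integral) auto
      also have "\<dots> = 1" using R m by simp
      finally show ?thesis
        by (auto simp: real_distribution_def real_distribution_axioms_def intro: prob_spaceI)
    qed
    have char: "char (density lborel (\<lambda>t. ennreal (R t / m))) a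
        = (LINT t|lborel. R t *\<^sub>R iexp (a * t)) /\<^sub>R m"
      if [measurable]: "R \<in> borel_measurable lborel" and R: "\<And>t. 0 \<le> R t" for R a
    proof -
      have "char (density lborel (\<lambda>t. ennreal (R t / m))) a
          = (LINT t|lborel. (R t / m) *\<^sub>R iexp (a * t))"
        unfolding char_def using R m by (intro integral_density) auto
      also have "\<dots> = (LINT t|lborel. (1 / m) *\<^sub>R (R t *\<^sub>R iexp (a * t)))"
        by simp
      also have "\<dots> = (LINT t|lborel. R t *\<^sub>R iexp (a * t)) /\<^sub>R m"
        by (subst integral_scaleR_right) (auto simp: divide_inverse)
      finally show ?thesis .
    qed
    have "density lborel (\<lambda>t. ennreal (P t / m)) = density lborel (\<lambda>t. ennreal (Q t / m))"
    proof (rule Levy_uniqueness)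
      show "real_distribution (density lborel (\<lambda>t. ennreal (P t / m)))"
        by (rule dist[OF _ PQ(1) nn(1) m_def]) simp
      show "real_distribution (density lborel (\<lambda>t. ennreal (Q t / m)))"
        by (rule dist[OF _ PQ(2) nn(2) mQ]) simp
      show "char (density lborel (\<lambda>t. ennreal (P t / m))) = char (density lborel (\<lambda>t. ennreal (Q t / m)))"
        by (rule ext) (subst char[OF _ nn(1)], simp, subst char[OF _ nn(2)], simp, simp only: eq)
    qed
    then have "AE t in lborel. ennreal (P t / m) = ennreal (Q t / m)"
      by (subst (asm) sigma_finite_measure.density_unique_iff[OF sigma_finite_lborel]) auto
    then show ?thesis
    proof eventually_elim
      case (elim t)
      then have "P t / m = Q t / m" using nn m by simp
      then show ?case using m by (simp add: DPQ)
    qed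
  qed
qed

lemma integrable_Fourier_injective:
  fixes D :: "real \<Rightarrow> complex"
  assumes D: "integrable lborel D"
    and F: "\<And>a. (LINT t|lborel. D t * iexp (a * t)) = 0"
  shows "AE t in lborel. D t = 0"
proof -
  have [measurable]: "D \<in> borel_measurable lborel" using D by auto
  have int: "integrable lborel (\<lambda>t. R t * iexp (a * t))" if "integrable lborel R" for R :: "real \<Rightarrow> complex" and a
    using that by (rule Bochner_Integration.integrable_bound) (use that in \<open>auto simp: norm_mult\<close>)
  have cD: "integrable lborel (\<lambda>t. cnj (D t))" using D by simp
  have Fc: "(LINT t|lborel. cnj (D t) * iexp (a * t)) = 0" for a
  proof -
    have "(LINT t|lborel. cnj (D t) * iexp (a * t)) = (LINT t|lborel. cnj (D t * iexp (- a * t)))"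
      by (simp add: exp_cnj)
    also have "\<dots> = cnj (LINT t|lborel. D t * iexp (- a * t))"
      by (rule Bochner_Integration.integral_cnj)
    finally show ?thesis using F[of "- a"] by simp
  qed
  have "(LINT t|lborel. Re (D t) *\<^sub>R iexp (a * t)) = 0" for a
  proof -
    have "Re (D t) *\<^sub>R iexp (a * t) = (1/2) * (D t * iexp (a * t) + cnj (D t) * iexp (a * t))" for t
      by (simp add: scaleR_conv_of_real complex_add_cnj flip: distrib_right)
    then have "(LINT t|lborel. Re (D t) *\<^sub>R iexp (a * t))
        = (LINT t|lborel. (1/2) * (D t * iexp (a * t) + cnj (D t) * iexp (a * t)))"
      by (intro Bochner_Integration.integral_cong refl)
    also have "\<dots> = (1/2) * ((LINT t|lborel. D t * iexp (a * t)) + (LINT t|lborel. cnj (D t) * iexp (a * t)))"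
      by (subst integral_mult_right_zero, subst Bochner_Integration.integral_add[OF int[OF D] int[OF cD]]) (rule refl)
    finally show ?thesis unfolding F Fc by simp
  qed
  then have Re: "AE t in lborel. Re (D t) = 0"
    using D by (intro integrable_real_Fourier_injective) auto
  have "(LINT t|lborel. Im (D t) *\<^sub>R iexp (a * t)) = 0" for a
  proof -
    have "Im (D t) *\<^sub>R iexp (a * t) = (- \<i> / 2) * (D t * iexp (a * t) - cnj (D t) * iexp (a * t))" for t
      by (simp add: scaleR_conv_of_real complex_diff_cnj algebra_simps flip: left_diff_distrib)
    then have "(LINT t|lborel. Im (D t) *\<^sub>R iexp (a * t))
        = (LINT t|lborel. (- \<i> / 2) * (D t * iexp (a * t) - cnj (D t) * iexp (a * t)))"
      by (intro Bochner_Integration.integral_cong refl)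
    also have "\<dots> = (- \<i> / 2) * ((LINT t|lborel. D t * iexp (a * t)) - (LINT t|lborel. cnj (D t) * iexp (a * t)))"
      by (subst integral_mult_right_zero, subst Bochner_Integration.integral_diff[OF int[OF D] int[OF cD]]) (rule refl)
    finally show ?thesis unfolding F Fc by simp
  qed
  then have Im: "AE t in lborel. Im (D t) = 0"
    using D by (intro integrable_real_Fourier_injective) auto
  from Re Im show ?thesis by eventually_elim (simp add: complex_eq_iff)
qed

definition truncated_Fourier :: "(real \<Rightarrow> complex) \<Rightarrow> real \<Rightarrow> real \<Rightarrow> complex" where
  "truncated_Fourier f N \<omega> =
     (LINT t|lborel. f t * (indicator {-N..N} t *\<^sub>R exp (- (\<i> * complex_of_real \<omega> * complex_of_real t))))"

lemma has_L2_fourier_iff_truncated: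
  "has_L2_fourier f g \<longleftrightarrow> f \<in> L2 \<and> g \<in> L2 \<and> L2_tendsto (truncated_Fourier f) g at_top"
  by (simp add: has_L2_fourier_def truncated_Fourier_def[abs_def] set_lebesgue_integral_def)

lemma truncated_Fourier_measurable:
  assumes [measurable]: "f \<in> borel_measurable lborel"
  shows "truncated_Fourier f N \<in> borel_measurable lborel"
  unfolding truncated_Fourier_def[abs_def] by measurable

lemma truncated_exponential_L2:
  "(\<lambda>t. indicator {-N..N} t *\<^sub>R exp (- (\<i> * complex_of_real \<omega> * complex_of_real t))) \<in> L2"
proof (rule L2_I)
  have "(cmod (indicator {-N..N} t *\<^sub>R exp (- (\<i> * complex_of_real \<omega> * complex_of_real t))))\<^sup>2
      = indicator {-N..N} t" for t
    by (simp add: indicator_def)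
  then show "(\<integral>\<^sup>+ t. ennreal ((cmod (indicator {-N..N} t *\<^sub>R exp (- (\<i> * complex_of_real \<omega> * complex_of_real t))))\<^sup>2) \<partial>lborel) < \<infinity>"
    by (simp add: ennreal_indicator emeasure_lborel_Icc_eq)
qed measurable

lemma truncated_Fourier_lincomb:
  assumes "f \<in> L2" "g \<in> L2"
  shows "truncated_Fourier (\<lambda>t. a * f t + b * g t) N \<omega>
    = a * truncated_Fourier f N \<omega> + b * truncated_Fourier g N \<omega>"
proof -
  define e where "e t = indicator {-N..N} t *\<^sub>R exp (- (\<i> * complex_of_real \<omega> * complex_of_real t))" for t
  have e: "e \<in> L2" unfolding e_def[abs_def] by (rule truncated_exponential_L2)
  have *: "truncated_Fourier h N \<omega> = (LINT t|lborel. h t * e t)" for h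
    by (simp only: truncated_Fourier_def e_def)
  show ?thesis
    unfolding * using L2_mult_integrable[OF assms(1) e] L2_mult_integrable[OF assms(2) e]
    by (simp add: distrib_right mult.assoc)
qed

text \<open>The convergence is stated with the nonnegative integral, which must therefore be finite
  eventually.\<close>

lemma has_L2_fourier_truncated_L2:
  assumes "has_L2_fourier f g"
  shows "\<forall>\<^sub>F N in at_top. truncated_Fourier f N \<in> L2"
proof -
  have fg: "f \<in> L2" "g \<in> L2" "L2_tendsto (truncated_Fourier f) g at_top"
    using assms by (auto simp: has_L2_fourier_iff_truncated)
  note [measurable] = L2_measurable[OF fg(1)] L2_measurable[OF fg(2)]
    truncated_Fourier_measurable[OF L2_measurable[OF fg(1)]]
  have "\<forall>\<^sub>F N in at_top. (\<integral>\<^sup>+ x. ennreal ((cmod (truncated_Fourier f N x - g x))\<^sup>2) \<partial>lborel) < 1"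
    using order_tendstoD(2)[OF fg(3)[unfolded L2_tendsto_def], of 1] by simp
  then show ?thesis
  proof eventually_elim
    case (elim N)
    then have "(\<integral>\<^sup>+ x. ennreal ((cmod (truncated_Fourier f N x - g x))\<^sup>2) \<partial>lborel) < \<infinity>"
      using order.strict_trans ennreal_one_less_top by fastforce
    then have "(\<lambda>x. truncated_Fourier f N x - g x) \<in> L2" by (intro L2_I) measurable
    from L2_add[OF this fg(2)] show ?case by simp
  qed
qed

lemma has_L2_fourier_norm_tendsto:
  assumes "has_L2_fourier f g"
  shows "((\<lambda>N. L2_norm (\<lambda>\<omega>. truncated_Fourier f N \<omega> - g \<omega>)) \<longlongrightarrow> 0) at_top"
  using assms L2_tendsto_iff_norm[OF has_L2_fourier_truncated_L2[OF assms]]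
  by (auto simp: has_L2_fourier_iff_truncated)

lemma has_L2_fourier_lincomb:
  assumes f: "has_L2_fourier f f'" and g: "has_L2_fourier g g'"
  shows "has_L2_fourier (\<lambda>t. a * f t + b * g t) (\<lambda>\<omega>. a * f' \<omega> + b * g' \<omega>)"
proof -
  have L: "f \<in> L2" "f' \<in> L2" "g \<in> L2" "g' \<in> L2"
    using f g by (auto simp: has_L2_fourier_def)
  note ev = eventually_conj[OF has_L2_fourier_truncated_L2[OF f] has_L2_fourier_truncated_L2[OF g]]
  have T: "truncated_Fourier (\<lambda>t. a * f t + b * g t) N
      = (\<lambda>\<omega>. a * truncated_Fourier f N \<omega> + b * truncated_Fourier g N \<omega>)" for N
    using L by (intro ext truncated_Fourier_lincomb)
  have "((\<lambda>N. L2_norm (\<lambda>\<omega>. truncated_Fourier (\<lambda>t. a * f t + b * g t) N \<omega> - (a * f' \<omega> + b * g' \<omega>))) \<longlongrightarrow> 0) at_top"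
  proof (rule Lim_null_comparison)
    show "((\<lambda>N. cmod a * L2_norm (\<lambda>\<omega>. truncated_Fourier f N \<omega> - f' \<omega>)
        + cmod b * L2_norm (\<lambda>\<omega>. truncated_Fourier g N \<omega> - g' \<omega>)) \<longlongrightarrow> 0) at_top"
      by (intro tendsto_add_zero tendsto_mult_right_zero has_L2_fourier_norm_tendsto f g)
    show "\<forall>\<^sub>F N in at_top. norm (L2_norm (\<lambda>\<omega>. truncated_Fourier (\<lambda>t. a * f t + b * g t) N \<omega> - (a * f' \<omega> + b * g' \<omega>)))
        \<le> cmod a * L2_norm (\<lambda>\<omega>. truncated_Fourier f N \<omega> - f' \<omega>)
        + cmod b * L2_norm (\<lambda>\<omega>. truncated_Fourier g N \<omega> - g' \<omega>)"
      using ev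
    proof eventually_elim
      case (elim N)
      have "L2_norm (\<lambda>\<omega>. a * (truncated_Fourier f N \<omega> - f' \<omega>) + b * (truncated_Fourier g N \<omega> - g' \<omega>))
          \<le> L2_norm (\<lambda>\<omega>. a * (truncated_Fourier f N \<omega> - f' \<omega>)) + L2_norm (\<lambda>\<omega>. b * (truncated_Fourier g N \<omega> - g' \<omega>))"
        using elim L by (intro L2_norm_triangle L2_scale L2_diff) auto
      moreover have "(\<lambda>\<omega>. a * (truncated_Fourier f N \<omega> - f' \<omega>) + b * (truncated_Fourier g N \<omega> - g' \<omega>))
          = (\<lambda>\<omega>. a * truncated_Fourier f N \<omega> + b * truncated_Fourier g N \<omega> - (a * f' \<omega> + b * g' \<omega>))"
        by (simp add: algebra_simps)
      ultimately show ?case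
        by (simp only: T L2_norm_scale real_norm_def abs_of_nonneg[OF L2_norm_nonneg])
    qed
  qed
  moreover have "\<forall>\<^sub>F N in at_top. truncated_Fourier (\<lambda>t. a * f t + b * g t) N \<in> L2"
    using ev by eventually_elim (auto simp: T intro: L2_lincomb)
  ultimately show ?thesis
    using L by (simp add: has_L2_fourier_iff_truncated L2_tendsto_iff_norm L2_lincomb)
qed

lemma has_L2_fourier_zero_left:
  assumes "has_L2_fourier (\<lambda>t. 0) g"
  shows "AE \<omega> in lborel. g \<omega> = 0"
proof (rule L2_norm_eq_0_AE)
  show "g \<in> L2" using assms by (simp add: has_L2_fourier_def)
  have "((\<lambda>N::real. L2_norm (\<lambda>\<omega>. - g \<omega>)) \<longlongrightarrow> 0) at_top"
    using has_L2_fourier_norm_tendsto[OF assms] by (simp add: truncated_Fourier_def)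
  then show "L2_norm g = 0"
    by (simp add: L2_norm_uminus tendsto_const_iff)
qed

lemma Gaussian_Fourier:
  "(LINT \<omega>|lborel. normal_density a 1 \<omega> *\<^sub>R exp (- (\<i> * complex_of_real \<omega> * complex_of_real t)))
    = exp (- (t\<^sup>2) / 2) *\<^sub>R iexp (- a * t)"
proof -
  have "(LINT \<omega>|lborel. normal_density a 1 \<omega> *\<^sub>R exp (- (\<i> * complex_of_real \<omega> * complex_of_real t)))
      = (LINT \<omega>|lborel. normal_density a 1 (a + 1 * \<omega>) *\<^sub>R exp (- (\<i> * complex_of_real (a + 1 * \<omega>) * complex_of_real t)))"
    by (subst lborel_integral_real_affine[of 1 _ a]) simp_all
  also have "\<dots> = (LINT \<omega>|lborel. (std_normal_density \<omega> *\<^sub>R iexp (- t * \<omega>)) * iexp (- a * t))"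
    by (intro Bochner_Integration.integral_cong refl)
      (simp add: normal_density_def algebra_simps flip: exp_add)
  also have "\<dots> = (LINT \<omega>|lborel. std_normal_density \<omega> *\<^sub>R iexp (- t * \<omega>)) * iexp (- a * t)"
    by (rule integral_mult_left_zero)
  also have "(LINT \<omega>|lborel. std_normal_density \<omega> *\<^sub>R iexp (- t * \<omega>)) = char std_normal_distribution (- t)"
    unfolding char_def by (subst integral_density) auto
  also have "\<dots> = exp (- (t\<^sup>2) / 2)" by (simp add: char_std_normal_distribution)
  finally show ?thesis by (simp add: scaleR_conv_of_real)
qed

lemma Gaussian_L2: "(\<lambda>\<omega>. complex_of_real (normal_density a 1 \<omega>)) \<in> L2"
proof -
  have "integrable lborel (\<lambda>\<omega>. (normal_density a 1 \<omega>)\<^sup>2)"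
  proof (rule Bochner_Integration.integrable_bound)
    show "integrable lborel (normal_density a 1)" by simp
    have "(normal_density a 1 \<omega>)\<^sup>2 \<le> normal_density a 1 \<omega>" for \<omega>
    proof -
      have "1 \<le> sqrt (2 * pi)" using pi_gt3 by simp
      moreover have "exp (- ((\<omega> - a)\<^sup>2 / 2)) \<le> 1" by simp
      ultimately have "exp (- ((\<omega> - a)\<^sup>2 / 2)) \<le> sqrt (2 * pi)" by linarith
      then have "normal_density a 1 \<omega> \<le> 1"
        by (simp add: normal_density_def divide_le_eq_1)
      then show ?thesis
        using mult_right_mono[of "normal_density a 1 \<omega>" 1 "normal_density a 1 \<omega>"]
        by (simp add: normal_density_nonneg power2_eq_square)
    qed
    then show "AE \<omega> in lborel. norm ((normal_density a 1 \<omega>)\<^sup>2) \<le> norm (normal_density a 1 \<omega>)"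
      by (simp add: normal_density_nonneg)
  qed measurable
  then show ?thesis by (simp add: L2_def)
qed

text \<open>By Fubini's theorem, testing a truncated transform against a Gaussian centred at \<open>a\<close> is testing
  \<open>f\<close> itself against the transform of that Gaussian, a Gaussian modulated with frequency \<open>a\<close>.\<close>

lemma truncated_Fourier_Gaussian:
  assumes f: "f \<in> L2"
  shows "(LINT \<omega>|lborel. truncated_Fourier f N \<omega> * complex_of_real (normal_density a 1 \<omega>))
    = (LINT t|lborel. indicator {-N..N} t *\<^sub>R (f t * exp (- (t\<^sup>2) / 2) *\<^sub>R iexp (- a * t)))"
proof -
  note [measurable] = L2_measurable[OF f]
  define H where "H t \<omega> = (f t * indicator {-N..N} t)
      * (normal_density a 1 \<omega> *\<^sub>R exp (- (\<i> * complex_of_real \<omega> * complex_of_real t)))" for t \<omega>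
  have fN: "integrable lborel (\<lambda>t. f t * indicator {-N..N} t)"
    using L2_mult_integrable[OF f truncated_exponential_L2[of N 0]]
    by (simp add: scaleR_conv_of_real of_real_indicator)
  have nH: "norm (H t \<omega>) = cmod (f t * indicator {-N..N} t) * normal_density a 1 \<omega>" for t \<omega>
    by (simp add: H_def norm_mult normal_density_nonneg)
  have "integrable (lborel \<Otimes>\<^sub>M lborel) (\<lambda>(t, \<omega>). H t \<omega>)"
  proof (rule lborel_pair.Fubini_integrable)
    show "(\<lambda>(t, \<omega>). H t \<omega>) \<in> borel_measurable (lborel \<Otimes>\<^sub>M lborel)"
      unfolding H_def by measurable
    show "integrable lborel (\<lambda>t. LINT \<omega>|lborel. norm (case (t, \<omega>) of (t, \<omega>) \<Rightarrow> H t \<omega>))"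
      using integrable_norm[OF fN] by (simp add: nH)
    have "integrable lborel (H t)" for t
    proof (rule Bochner_Integration.integrable_bound)
      show "integrable lborel (\<lambda>\<omega>. cmod (f t * indicator {-N..N} t) * normal_density a 1 \<omega>)" by simp
      show "AE \<omega> in lborel. norm (H t \<omega>) \<le> norm (cmod (f t * indicator {-N..N} t) * normal_density a 1 \<omega>)"
        by (simp add: nH)
    qed (unfold H_def, measurable)
    then show "AE t in lborel. integrable lborel (\<lambda>\<omega>. case (t, \<omega>) of (t, \<omega>) \<Rightarrow> H t \<omega>)" by simp
  qed
  then have "(LINT \<omega>|lborel. LINT t|lborel. H t \<omega>) = (LINT t|lborel. LINT \<omega>|lborel. H t \<omega>)"
    by (rule lborel_pair.Fubini_integral)
  moreover have "(LINT t|lborel. H t \<omega>)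
      = truncated_Fourier f N \<omega> * complex_of_real (normal_density a 1 \<omega>)" for \<omega>
    unfolding truncated_Fourier_def integral_mult_left_zero[symmetric] H_def
    by (intro Bochner_Integration.integral_cong refl) (auto simp: indicator_def scaleR_conv_of_real)
  moreover have "(LINT \<omega>|lborel. H t \<omega>)
      = indicator {-N..N} t *\<^sub>R (f t * exp (- (t\<^sup>2) / 2) *\<^sub>R iexp (- a * t))" for t
    unfolding H_def integral_mult_right_zero Gaussian_Fourier by (simp add: indicator_def)
  ultimately show ?thesis by simp
qed

text \<open>A square-integrable function need not be integrable, but its product \<open>D\<close> with a Gaussian is. Testing the
  truncated transforms of \<open>f\<close> against Gaussians centred at \<open>a\<close> and removing the truncation shows that
  the ordinary Fourier transform of \<open>D\<close> vanishes at every frequency \<open>a\<close>.\<close>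

lemma L2_fourier_injective:
  assumes "has_L2_fourier f g" and g0: "AE \<omega> in lborel. g \<omega> = 0"
  shows "AE t in lborel. f t = 0"
proof -
  have L: "f \<in> L2" "g \<in> L2" using assms(1) by (auto simp: has_L2_fourier_def)
  note [measurable] = L2_measurable[OF L(1)] L2_measurable[OF L(2)]
  define D where "D t = f t * exp (- (t\<^sup>2) / 2)" for t
  have [measurable]: "D \<in> borel_measurable lborel" unfolding D_def by measurable
  have "D = (\<lambda>t. f t * complex_of_real (normal_density 0 1 t) * sqrt (2 * pi))"
    by (simp add: D_def normal_density_def fun_eq_iff)
  then have D: "integrable lborel D"
    using L2_mult_integrable[OF L(1) Gaussian_L2[of 0]] by simp
  have "(LINT t|lborel. D t * iexp (- a * t)) = 0" for a
  proof (rule tendsto_unique)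
    let ?T = "\<lambda>N. LINT \<omega>|lborel. truncated_Fourier f N \<omega> * complex_of_real (normal_density a 1 \<omega>)"
    show "(?T \<longlongrightarrow> 0) at_top"
    proof (rule Lim_null_comparison)
      let ?G = "\<lambda>\<omega>. complex_of_real (normal_density a 1 \<omega>)"
      show "((\<lambda>N. L2_norm (\<lambda>\<omega>. truncated_Fourier f N \<omega> - g \<omega>) * L2_norm ?G) \<longlongrightarrow> 0) at_top"
        by (intro tendsto_mult_left_zero has_L2_fourier_norm_tendsto assms)
      show "\<forall>\<^sub>F N in at_top. norm (?T N) \<le> L2_norm (\<lambda>\<omega>. truncated_Fourier f N \<omega> - g \<omega>) * L2_norm ?G"
        using has_L2_fourier_truncated_L2[OF assms(1)]
      proof eventually_elim
        case (elim N)
        note [measurable] = L2_measurable[OF elim]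
        have "?T N = (LINT \<omega>|lborel. (truncated_Fourier f N \<omega> - g \<omega>) * ?G \<omega>)"
          using g0 by (intro integral_cong_AE) auto
        then show ?case
          using L2_Cauchy_Schwarz_integral[OF L2_diff[OF elim L(2)] Gaussian_L2[of a]] by simp
      qed
    qed
    have "((\<lambda>N. LINT t|lborel. indicator {-N..N} t *\<^sub>R (D t * iexp (- a * t)))
        \<longlongrightarrow> (LINT t|lborel. D t * iexp (- a * t))) at_top"
    proof (rule integral_dominated_convergence_at_top[where w = "\<lambda>t. cmod (D t)"])
      show "AE t in lborel. ((\<lambda>N. indicator {-N..N} t *\<^sub>R (D t * iexp (- a * t)))
          \<longlongrightarrow> D t * iexp (- a * t)) at_top"
      proof (rule AE_I2, rule tendsto_eventually, rule eventually_mono[OF eventually_ge_at_top])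
        fix t N :: real assume "\<bar>t\<bar> \<le> N"
        then show "indicator {-N..N} t *\<^sub>R (D t * iexp (- a * t)) = D t * iexp (- a * t)"
          by (simp add: indicator_def abs_le_iff)
      qed
    qed (use D in \<open>auto simp: norm_mult indicator_def\<close>)
    then show "(?T \<longlongrightarrow> (LINT t|lborel. D t * iexp (- a * t))) at_top"
      unfolding truncated_Fourier_Gaussian[OF L(1)] D_def
      by (simp add: scaleR_conv_of_real mult.assoc)
  qed simp
  from this[of "- a" for a] have "AE t in lborel. D t = 0"
    by (intro integrable_Fourier_injective D) simp
  then show ?thesis by eventually_elim (simp add: D_def)
qed

section \<open>Linearity of the forward operator and the Bessel bound\<close>

text \<open>The image of a combination and the combination of the images have almost everywhere the same Fourier
  transform, since both are the symbol times the transform of the argument.\<close>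

lemma heat_operator_lincomb:
  assumes K: "heat_operator \<gamma> T K" and f: "f \<in> L2" and g: "g \<in> L2"
  shows "AE x in lborel. K (\<lambda>t. a * f t + b * g t) x = a * K f x + b * K g x"
proof -
  define h where "h \<omega> = complex_of_real (heat_symbol \<gamma> T \<omega>)" for \<omega>
  define k where "k t = a * f t + b * g t" for t
  have k: "k \<in> L2" unfolding k_def[abs_def] by (intro L2_lincomb f g)
  have ex: "\<exists>g. has_L2_fourier \<theta> g \<and> has_L2_fourier (K \<theta>) (\<lambda>\<omega>. h \<omega> * g \<omega>)" if "\<theta> \<in> L2" for \<theta>
    using K that by (auto simp: heat_operator_def h_def)
  obtain f' where f': "has_L2_fourier f f'" "has_L2_fourier (K f) (\<lambda>\<omega>. h \<omega> * f' \<omega>)"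
    using ex[OF f] by blast
  obtain g' where g': "has_L2_fourier g g'" "has_L2_fourier (K g) (\<lambda>\<omega>. h \<omega> * g' \<omega>)"
    using ex[OF g] by blast
  obtain k' where k': "has_L2_fourier k k'" "has_L2_fourier (K k) (\<lambda>\<omega>. h \<omega> * k' \<omega>)"
    using ex[OF k] by blast
  have "has_L2_fourier (\<lambda>t. 1 * k t + (-1) * (a * f t + b * g t))
      (\<lambda>\<omega>. 1 * k' \<omega> + (-1) * (a * f' \<omega> + b * g' \<omega>))"
    by (intro has_L2_fourier_lincomb f' g' k')
  then have "AE \<omega> in lborel. 1 * k' \<omega> + (-1) * (a * f' \<omega> + b * g' \<omega>) = 0"
    by (intro has_L2_fourier_zero_left) (simp add: k_def)
  then have 0: "AE \<omega> in lborel. 1 * (h \<omega> * k' \<omega>) + (-1) * (a * (h \<omega> * f' \<omega>) + b * (h \<omega> * g' \<omega>)) = 0"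
    by eventually_elim (simp add: algebra_simps)
  have "has_L2_fourier (\<lambda>t. 1 * K k t + (-1) * (a * K f t + b * K g t))
      (\<lambda>\<omega>. 1 * (h \<omega> * k' \<omega>) + (-1) * (a * (h \<omega> * f' \<omega>) + b * (h \<omega> * g' \<omega>)))"
    by (intro has_L2_fourier_lincomb f' g' k')
  from this 0 have "AE t in lborel. 1 * K k t + (-1) * (a * K f t + b * K g t) = 0"
    by (rule L2_fourier_injective)
  then show ?thesis unfolding k_def[abs_def]
    by eventually_elim (simp only: mult_1 mult_minus1 add_uminus_conv_diff right_minus_eq)
qed

lemma L2_closed_range_lincomb:
  assumes map: "\<And>f. f \<in> L2 \<Longrightarrow> K f \<in> L2"
    and lin: "\<And>f g a b. f \<in> L2 \<Longrightarrow> g \<in> L2 \<Longrightarrow>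
      AE x in lborel. K (\<lambda>t. a * f t + b * g t) x = a * K f x + b * K g x"
    and z: "z \<in> L2_closed_range K" and w: "w \<in> L2_closed_range K"
  shows "(\<lambda>x. a * z x + b * w x) \<in> L2_closed_range K"
proof -
  have L: "z \<in> L2" "w \<in> L2" using z w by (auto simp: L2_closed_range_def)
  have "\<exists>f\<in>L2. L2_norm (\<lambda>x. K f x - (a * z x + b * w x)) < e" if "0 < e" for e
  proof -
    \<comment> \<open>The summand 1 keeps the denominator positive when both coefficients vanish.\<close>
    define d where "d = e / (cmod a + cmod b + 1)"
    have p: "0 < cmod a + cmod b + 1" by (simp add: add_nonneg_pos)
    then have d: "0 < d" using that by (simp add: d_def)
    obtain f where f: "f \<in> L2" "L2_norm (\<lambda>x. K f x - z x) < d"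
      using z d by (auto simp: L2_closed_range_def)
    obtain g where g: "g \<in> L2" "L2_norm (\<lambda>x. K g x - w x) < d"
      using w d by (auto simp: L2_closed_range_def)
    define k where "k t = a * f t + b * g t" for t
    have k: "k \<in> L2" unfolding k_def[abs_def] by (intro L2_lincomb f g)
    note KL = map[OF f(1)] map[OF g(1)] map[OF k]
    have "L2_norm (\<lambda>x. K k x - (a * z x + b * w x))
        = L2_norm (\<lambda>x. a * (K f x - z x) + b * (K g x - w x))"
    proof (rule L2_norm_cong_AE)
      show "(\<lambda>x. K k x - (a * z x + b * w x)) \<in> borel_measurable lborel"
        by (intro L2_measurable L2_diff L2_lincomb KL L)
      show "(\<lambda>x. a * (K f x - z x) + b * (K g x - w x)) \<in> borel_measurable lborel"
        by (intro L2_measurable L2_diff L2_lincomb KL L)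
      show "AE x in lborel. K k x - (a * z x + b * w x) = a * (K f x - z x) + b * (K g x - w x)"
        using lin[OF f(1) g(1), of a b] unfolding k_def[abs_def]
        by eventually_elim (simp add: algebra_simps)
    qed
    also have "\<dots> \<le> cmod a * L2_norm (\<lambda>x. K f x - z x) + cmod b * L2_norm (\<lambda>x. K g x - w x)"
      using L2_norm_triangle[OF L2_scale[OF L2_diff[OF KL(1) L(1)]] L2_scale[OF L2_diff[OF KL(2) L(2)]], of a b]
      by (simp only: L2_norm_scale)
    also have "\<dots> \<le> cmod a * d + cmod b * d"
      using f(2) g(2) by (intro add_mono mult_left_mono) auto
    also have "\<dots> < (cmod a + cmod b + 1) * d" using d by (simp add: algebra_simps)
    also have "\<dots> = e" using p by (simp add: d_def)
    finally show ?thesis using k by blast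
  qed
  then show ?thesis using L by (simp add: L2_closed_range_def L2_lincomb)
qed

lemma square_le_mult_imp_le:
  fixes x c :: real
  assumes "x * x \<le> c * x" "0 \<le> x" "0 \<le> c"
  shows "x \<le> c"
  using assms by (cases "x = 0") (simp_all add: mult_le_cancel_right)

text \<open>With \<open>c i = \<langle>w, v i\<rangle>\<close>, the vector \<open>z = (\<Sum>i\<in>J. c i v i)\<close> lies in \<open>V\<close>, where the frame bound
  gives \<open>\<parallel>z\<parallel>\<^sup>2 \<le> B * (\<Sum>i\<in>J. |c i|\<^sup>2)\<close>. On the other hand \<open>(\<Sum>i\<in>J. |c i|\<^sup>2) = \<langle>w, z\<rangle> \<le> \<parallel>w\<parallel> * \<parallel>z\<parallel>\<close>. Eliminating
  \<open>\<parallel>z\<parallel>\<close> gives the claim.\<close>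

lemma frame_Bessel:
  assumes V: "V \<subseteq> L2" "\<And>z w a b. z \<in> V \<Longrightarrow> w \<in> V \<Longrightarrow> (\<lambda>x. a * z x + b * w x) \<in> V"
    and v: "frame_over V v A B" and w: "w \<in> L2" and J: "finite J"
  shows "(\<Sum>i\<in>J. (cmod (L2_inner w (v i)))\<^sup>2) \<le> B * (L2_norm w)\<^sup>2"
proof -
  have vV: "v i \<in> V" and vL: "v i \<in> L2" and B: "0 < B" for i
    using v V(1) by (auto simp: frame_over_def)
  have V0: "(\<lambda>x. 0) \<in> V" using V(2)[OF vV vV, of 0 undefined 0 undefined] by simp
  define c where "c i = L2_inner w (v i)" for i
  define z where "z x = (\<Sum>i\<in>J. c i * v i x)" for x
  define S where "S = (\<Sum>i\<in>J. (cmod (c i))\<^sup>2)"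
  have "(\<lambda>x. \<Sum>i\<in>J. c i * v i x) \<in> V"
    using J
  proof (induction J rule: finite_induct)
    case (insert i J)
    then show ?case using V(2)[OF vV insert.IH, of "c i" i 1] by simp
  qed (simp add: V0)
  then have zV: "z \<in> V" and zL: "z \<in> L2" using V(1) by (auto simp: z_def[abs_def])
  have S0: "0 \<le> S" by (simp add: S_def sum_nonneg)
  have inner: "L2_inner k z = (\<Sum>i\<in>J. cnj (c i) * L2_inner k (v i))" if "k \<in> L2" for k
    unfolding z_def[abs_def] using that
    by (simp add: L2_inner_sum_right[OF J L2_scale[OF vL]] L2_inner_scale_right)
  have "complex_of_real S = L2_inner w z"
    unfolding inner[OF w] S_def c_def[symmetric] of_real_sum complex_norm_square
    by (simp add: mult.commute)
  then have "S = cmod (L2_inner w z)"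
    using S0 by (metis norm_of_real abs_of_nonneg)
  then have 1: "S \<le> L2_norm w * L2_norm z"
    using L2_Cauchy_Schwarz[OF w zL] by simp
  have sm: "(\<lambda>i. (cmod (L2_inner z (v i)))\<^sup>2) summable_on UNIV"
    and up: "(\<Sum>\<^sub>\<infinity>i. (cmod (L2_inner z (v i)))\<^sup>2) \<le> B * (L2_norm z)\<^sup>2"
    using v zV by (auto simp: frame_over_def)
  have "L2_set (\<lambda>i. cmod (L2_inner z (v i))) J \<le> sqrt (B * (L2_norm z)\<^sup>2)"
    unfolding L2_set_def
    using order_trans[OF finite_sum_le_infsum[OF sm J] up] by simp
  then have fr: "L2_set (\<lambda>i. cmod (L2_inner z (v i))) J \<le> sqrt B * L2_norm z"
    by (simp add: real_sqrt_mult L2_norm_nonneg)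
  have "(L2_norm z)\<^sup>2 = cmod (L2_inner z z)" by (simp add: L2_inner_self del: of_real_power)
  also have "\<dots> \<le> (\<Sum>i\<in>J. cmod (c i) * cmod (L2_inner z (v i)))"
    unfolding inner[OF zL] by (rule order_trans[OF norm_sum]) (simp add: norm_mult)
  also have "\<dots> \<le> L2_set (\<lambda>i. cmod (c i)) J * L2_set (\<lambda>i. cmod (L2_inner z (v i))) J"
    using L2_set_mult_ineq[of "\<lambda>i. cmod (c i)" "\<lambda>i. cmod (L2_inner z (v i))" J] by simp
  also have "\<dots> \<le> sqrt S * (sqrt B * L2_norm z)"
    unfolding S_def L2_set_def[of "\<lambda>i. cmod (c i)"] using fr
    by (intro mult_left_mono) (auto simp: sum_nonneg)
  finally have "L2_norm z * L2_norm z \<le> (sqrt S * sqrt B) * L2_norm z"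
    by (simp add: power2_eq_square mult.assoc)
  then have "L2_norm z \<le> sqrt S * sqrt B"
    by (rule square_le_mult_imp_le) (use S0 B in \<open>auto simp: L2_norm_nonneg\<close>)
  then have "L2_norm w * L2_norm z \<le> L2_norm w * (sqrt S * sqrt B)"
    by (intro mult_left_mono L2_norm_nonneg)
  moreover have "sqrt S * sqrt S = S" using S0 by simp
  moreover have "L2_norm w * (sqrt S * sqrt B) = (sqrt B * L2_norm w) * sqrt S"
    by (simp only: mult_ac)
  ultimately have "sqrt S * sqrt S \<le> (sqrt B * L2_norm w) * sqrt S"
    using 1 by linarith
  then have "sqrt S \<le> sqrt B * L2_norm w"
    by (rule square_le_mult_imp_le) (use S0 B in \<open>auto simp: L2_norm_nonneg\<close>)
  then have "(sqrt S)\<^sup>2 \<le> (sqrt B * L2_norm w)\<^sup>2" using S0 by (intro power_mono) auto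
  then show ?thesis using S0 B by (simp add: power_mult_distrib S_def c_def)
qed

section \<open>Error estimates in coordinates\<close>

text \<open>Up to the factor \<open>\<alpha> powr t\<close>, the left-hand side is \<open>\<alpha> powr (1 - t) * q powr t\<close>, a weighted geometric
  mean of \<open>\<alpha>\<close> and \<open>q\<close>, hence at most the larger of the two.\<close>

lemma filter_powr_bound:
  fixes \<alpha> q t :: real
  assumes "0 < \<alpha>" "0 < q" "0 \<le> t" "t \<le> 1"
  shows "\<alpha> * q powr t \<le> \<alpha> powr t * (\<alpha> + q)"
proof (cases "q \<le> \<alpha>")
  case True
  then have "q powr t \<le> \<alpha> powr t" using assms by (intro powr_mono2) auto
  then have "\<alpha> * q powr t \<le> \<alpha> * \<alpha> powr t" using assms by simp
  also have "\<dots> \<le> \<alpha> powr t * (\<alpha> + q)" using assms by (simp add: algebra_simps)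
  finally show ?thesis .
next
  case False
  have "\<alpha> * q powr t = \<alpha> powr t * (\<alpha> powr (1 - t) * q powr t)"
    using assms by (simp add: mult.assoc[symmetric] flip: powr_add)
  also have "\<dots> \<le> \<alpha> powr t * (q powr (1 - t) * q powr t)"
    using False assms by (intro mult_left_mono mult_right_mono powr_mono2) auto
  also have "q powr (1 - t) * q powr t = q"
    using assms by (simp flip: powr_add)
  also have "\<alpha> powr t * q \<le> \<alpha> powr t * (\<alpha> + q)" using assms by (intro mult_left_mono) auto
  finally show ?thesis .
qed

text \<open>For interpolating between two weighted norms: below the scale \<open>\<mu>\<close> the
  negative power of \<open>\<kappa>\<close> dominates, above it the positive one.\<close>

lemma interpolation_weights:
  fixes \<kappa> \<mu> s :: real
  assumes "0 < \<kappa>" "0 < \<mu>" "0 \<le> s"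
  shows "1 \<le> \<kappa> / \<mu> + \<mu> powr s * \<kappa> powr (- s)"
proof (cases "\<mu> \<le> \<kappa>")
  case True
  then have "1 \<le> \<kappa> / \<mu>" using assms by simp
  then show ?thesis by (simp add: add_increasing2)
next
  case False
  then have "\<kappa> powr s \<le> \<mu> powr s" using assms by (intro powr_mono2) auto
  then have "1 \<le> \<mu> powr s * \<kappa> powr (- s)" using assms by (simp add: powr_minus field_simps)
  then show ?thesis using assms by (simp add: add_increasing)
qed

lemma L2_set_le_add:
  assumes "finite J" "\<And>i. i \<in> J \<Longrightarrow> 0 \<le> f i" "\<And>i. i \<in> J \<Longrightarrow> f i \<le> g i + h i"
    and "L2_set g J \<le> a" "L2_set h J \<le> b"
  shows "L2_set f J \<le> a + b"
proof -
  have "L2_set f J \<le> L2_set (\<lambda>i. g i + h i) J" using assms by (intro L2_set_mono) auto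
  also have "\<dots> \<le> L2_set g J + L2_set h J" by (rule L2_set_triangle_ineq)
  finally show ?thesis using assms by linarith
qed

lemma L2_set_le_scaled:
  assumes "0 \<le> c" "\<And>i. i \<in> J \<Longrightarrow> 0 \<le> f i" "\<And>i. i \<in> J \<Longrightarrow> f i \<le> c * g i" "L2_set g J \<le> a"
  shows "L2_set f J \<le> c * a"
proof -
  have "L2_set f J \<le> L2_set (\<lambda>i. c * g i) J" using assms by (intro L2_set_mono) auto
  also have "\<dots> = c * L2_set g J" by (rule L2_set_right_distrib[symmetric, OF assms(1)])
  finally show ?thesis using mult_left_mono[OF assms(4,1)] by linarith
qed

text \<open>At the singular value \<open>\<mu> = (\<delta> / E) powr (2 / (p + 2))\<close> the amplified noise \<open>\<delta> / \<mu>\<close> and the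
  smoothness term \<open>\<mu> powr (p / 2) * E\<close> are equal, and both are the optimal rate.\<close>

lemma balance_scale:
  fixes p \<delta> E :: real
  assumes "0 < p" "0 < E" "0 < \<delta>"
  shows "\<delta> / (\<delta> / E) powr (2 / (p + 2)) = \<delta> powr (p / (p + 2)) * E powr (2 / (p + 2))"
    and "\<delta> powr (p / (p + 2)) * E powr (2 / (p + 2)) = ((\<delta> / E) powr (2 / (p + 2))) powr (p / 2) * E"
proof -
  have e: "p / (p + 2) = 1 - 2 / (p + 2)" using assms(1) by (simp add: field_simps)
  show "\<delta> / (\<delta> / E) powr (2 / (p + 2)) = \<delta> powr (p / (p + 2)) * E powr (2 / (p + 2))"
    using assms by (simp add: e powr_diff powr_divide)
  have e': "2 / (p + 2) = 1 - p / (p + 2)" using assms(1) by (simp add: field_simps)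
  have "((\<delta> / E) powr (2 / (p + 2))) powr (p / 2) = (\<delta> / E) powr (p / (p + 2))"
  proof -
    have "2 / (p + 2) * (p / 2) = p / (p + 2)" using assms(1) by (simp add: field_simps)
    then show ?thesis by (simp only: powr_powr)
  qed
  then show "\<delta> powr (p / (p + 2)) * E powr (2 / (p + 2)) = ((\<delta> / E) powr (2 / (p + 2))) powr (p / 2) * E"
    using assms by (simp add: e' powr_diff powr_divide)
qed

text \<open>The properties of a diagonal frame decomposition that enter the error analysis. The Bessel inequality
  is required for every \<open>w\<close> because the data may lie outside the closed range of \<open>K\<close>.\<close>

locale diagonal_system =
  fixes K :: "(real \<Rightarrow> complex) \<Rightarrow> (real \<Rightarrow> complex)"
    and u v :: "'i \<Rightarrow> real \<Rightarrow> complex" and \<kappa> :: "'i \<Rightarrow> real" and A B :: real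
  assumes onb: "orthonormal_basis u"
    and \<kappa>_pos: "0 < \<kappa> i"
    and v_L2: "v i \<in> L2"
    and K_L2: "f \<in> L2 \<Longrightarrow> K f \<in> L2"
    and K_coefficient: "f \<in> L2 \<Longrightarrow> L2_inner (K f) (v i) = \<kappa> i * L2_inner f (u i)"
    and A_pos: "0 < A" and B_pos: "0 < B"
    and Bessel: "w \<in> L2 \<Longrightarrow> finite J \<Longrightarrow> (\<Sum>i\<in>J. (cmod (L2_inner w (v i)))\<^sup>2) \<le> B * (L2_norm w)\<^sup>2"
    and K_lower: "f \<in> L2 \<Longrightarrow> A * (L2_norm (K f))\<^sup>2 \<le> (\<Sum>\<^sub>\<infinity>i. (cmod (L2_inner (K f) (v i)))\<^sup>2)"
begin

lemma u_L2: "u i \<in> L2"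
  by (rule orthonormal_basis_L2[OF onb])

lemma Bessel_L2_set:
  assumes "w \<in> L2" "finite J"
  shows "L2_set (\<lambda>i. cmod (L2_inner w (v i))) J \<le> sqrt B * L2_norm w"
proof -
  have "sqrt (\<Sum>i\<in>J. (cmod (L2_inner w (v i)))\<^sup>2) \<le> sqrt (B * (L2_norm w)\<^sup>2)"
    using Bessel[OF assms] by simp
  then show ?thesis by (simp add: L2_set_def real_sqrt_mult L2_norm_nonneg)
qed

lemma filter_noise_bound:
  assumes "0 < \<alpha>"
  shows "\<kappa> i / (\<alpha> + (\<kappa> i)\<^sup>2) \<le> 1 / sqrt \<alpha>"
proof -
  have half: "X \<le> D" if "0 \<le> X" "2 * X \<le> D" for X D :: real using that by linarith
  have "0 \<le> sqrt \<alpha> * \<kappa> i" using assms \<kappa>_pos[of i] by simp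
  moreover have "2 * (sqrt \<alpha> * \<kappa> i) \<le> \<alpha> + (\<kappa> i)\<^sup>2"
    using sum_squares_bound[of "sqrt \<alpha>" "\<kappa> i"] assms by (simp add: mult.assoc)
  ultimately have "sqrt \<alpha> * \<kappa> i \<le> \<alpha> + (\<kappa> i)\<^sup>2" by (rule half)
  moreover have "0 < \<alpha> + (\<kappa> i)\<^sup>2" "0 < sqrt \<alpha>" using assms by (simp_all add: add_pos_nonneg)
  ultimately show ?thesis by (simp add: divide_le_eq pos_le_divide_eq mult.commute)
qed

lemma filter_summable:
  assumes y: "y \<in> L2" and \<alpha>: "0 < \<alpha>"
  shows "(\<lambda>i. (cmod (complex_of_real (\<kappa> i / (\<alpha> + (\<kappa> i)\<^sup>2)) * L2_inner y (v i)))\<^sup>2) summable_on UNIV"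
proof (rule nonneg_bdd_above_summable_on)
  have "(\<Sum>i\<in>J. (cmod (complex_of_real (\<kappa> i / (\<alpha> + (\<kappa> i)\<^sup>2)) * L2_inner y (v i)))\<^sup>2)
      \<le> (1 / sqrt \<alpha>)\<^sup>2 * (B * (L2_norm y)\<^sup>2)" if J: "finite J" for J
  proof -
    have "(\<Sum>i\<in>J. (cmod (complex_of_real (\<kappa> i / (\<alpha> + (\<kappa> i)\<^sup>2)) * L2_inner y (v i)))\<^sup>2)
        \<le> (\<Sum>i\<in>J. (1 / sqrt \<alpha>)\<^sup>2 * (cmod (L2_inner y (v i)))\<^sup>2)"
    proof (rule sum_mono)
      fix i
      have g: "0 \<le> \<kappa> i / (\<alpha> + (\<kappa> i)\<^sup>2)" using \<alpha> \<kappa>_pos[of i] by simp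
      show "(cmod (complex_of_real (\<kappa> i / (\<alpha> + (\<kappa> i)\<^sup>2)) * L2_inner y (v i)))\<^sup>2
          \<le> (1 / sqrt \<alpha>)\<^sup>2 * (cmod (L2_inner y (v i)))\<^sup>2"
        unfolding norm_mult power_mult_distrib norm_of_real abs_of_nonneg[OF g]
        by (intro mult_right_mono power_mono filter_noise_bound \<alpha> g) simp
    qed
    also have "\<dots> \<le> (1 / sqrt \<alpha>)\<^sup>2 * (B * (L2_norm y)\<^sup>2)"
      unfolding sum_distrib_left[symmetric] by (intro mult_left_mono Bessel y J) auto
    finally show ?thesis .
  qed
  then show "bdd_above (sum (\<lambda>i. (cmod (complex_of_real (\<kappa> i / (\<alpha> + (\<kappa> i)\<^sup>2)) * L2_inner y (v i)))\<^sup>2)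
      ` {F. F \<subseteq> UNIV \<and> finite F})"
    by (intro bdd_aboveI) auto
qed simp

lemma regularized_L2: "y \<in> L2 \<Longrightarrow> 0 < \<alpha> \<Longrightarrow> regularized u v \<kappa> \<alpha> y \<in> L2"
  unfolding regularized_def by (intro L2_suminf_orthonormal_basis onb filter_summable)

lemma regularized_coefficient:
  "y \<in> L2 \<Longrightarrow> 0 < \<alpha> \<Longrightarrow>
    L2_inner (regularized u v \<kappa> \<alpha> y) (u i) = complex_of_real (\<kappa> i / (\<alpha> + (\<kappa> i)\<^sup>2)) * L2_inner y (v i)"
  unfolding regularized_def by (intro L2_suminf_orthonormal_basis(2) onb filter_summable)

lemma noise_coefficient:
  assumes "x \<in> L2" "y \<in> L2"
  shows "L2_inner (\<lambda>t. y t - K x t) (v i) = L2_inner y (v i) - \<kappa> i * L2_inner x (u i)"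
  using assms by (simp add: L2_inner_diff_left K_L2 v_L2 K_coefficient)

lemma noise_L2_set:
  assumes "x \<in> L2" "y \<in> L2" "L2_norm (\<lambda>t. y t - K x t) \<le> \<delta>" "finite J"
  shows "L2_set (\<lambda>i. cmod (L2_inner y (v i) - \<kappa> i * L2_inner x (u i))) J \<le> sqrt B * \<delta>"
proof -
  have "L2_set (\<lambda>i. cmod (L2_inner (\<lambda>t. y t - K x t) (v i))) J \<le> sqrt B * L2_norm (\<lambda>t. y t - K x t)"
    using assms by (intro Bessel_L2_set L2_diff K_L2)
  also have "\<dots> \<le> sqrt B * \<delta>" using assms(3) B_pos by simp
  finally show ?thesis by (simp add: noise_coefficient[OF assms(1,2)])
qed

text \<open>The coordinate of the error is
  \<open>\<kappa> i / (\<alpha> + (\<kappa> i)\<^sup>2) * (y i - \<kappa> i * x i) - \<alpha> / (\<alpha> + (\<kappa> i)\<^sup>2) * x i\<close>: filtered noise minus bias.\<close>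

lemma regularized_error_le:
  assumes x: "x \<in> L2" and y: "y \<in> L2" and noise: "L2_norm (\<lambda>t. y t - K x t) \<le> \<delta>" and \<alpha>: "0 < \<alpha>"
    and b: "\<And>J. finite J \<Longrightarrow> L2_set (\<lambda>i. \<alpha> / (\<alpha> + (\<kappa> i)\<^sup>2) * cmod (L2_inner x (u i))) J \<le> b"
  shows "L2_norm (\<lambda>t. regularized u v \<kappa> \<alpha> y t - x t) \<le> sqrt B * \<delta> / sqrt \<alpha> + b"
proof (rule L2_norm_le_coefficients[OF onb])
  note r = regularized_L2[OF y \<alpha>]
  show "(\<lambda>t. regularized u v \<kappa> \<alpha> y t - x t) \<in> L2" by (intro L2_diff r x)
  have "0 \<le> \<delta>" using noise L2_norm_nonneg order_trans by blast
  moreover have "0 \<le> b" using b[of "{}"] by simp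
  ultimately show "0 \<le> sqrt B * \<delta> / sqrt \<alpha> + b" using \<alpha> B_pos by simp
  fix J :: "'i set" assume J: "finite J"
  let ?n = "\<lambda>i. cmod (L2_inner y (v i) - \<kappa> i * L2_inner x (u i))"
  have n: "L2_set (\<lambda>i. \<kappa> i / (\<alpha> + (\<kappa> i)\<^sup>2) * ?n i) J \<le> 1 / sqrt \<alpha> * (sqrt B * \<delta>)"
    using \<alpha> \<kappa>_pos
    by (intro L2_set_le_scaled[OF _ _ _ noise_L2_set[OF x y noise J]] mult_right_mono filter_noise_bound)
      (auto simp: less_imp_le)
  have "cmod (L2_inner (\<lambda>t. regularized u v \<kappa> \<alpha> y t - x t) (u i))
      \<le> \<kappa> i / (\<alpha> + (\<kappa> i)\<^sup>2) * ?n i + \<alpha> / (\<alpha> + (\<kappa> i)\<^sup>2) * cmod (L2_inner x (u i))" for i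
  proof -
    have d: "0 < \<alpha> + (\<kappa> i)\<^sup>2" using \<alpha> by (simp add: add_pos_nonneg)
    define g where "g = \<kappa> i / (\<alpha> + (\<kappa> i)\<^sup>2)"
    define q where "q = \<alpha> / (\<alpha> + (\<kappa> i)\<^sup>2)"
    have gq: "0 \<le> g" "0 \<le> q" using \<alpha> \<kappa>_pos[of i] d by (simp_all add: g_def q_def)
    have "g * \<kappa> i + q = 1" using d by (simp add: g_def q_def power2_eq_square add.commute flip: add_divide_distrib)
    then have q: "complex_of_real q = 1 - complex_of_real g * complex_of_real (\<kappa> i)"
      by (metis add_diff_cancel_left' of_real_1 of_real_add of_real_mult)
    have "L2_inner (\<lambda>t. regularized u v \<kappa> \<alpha> y t - x t) (u i)
        = complex_of_real g * (L2_inner y (v i) - \<kappa> i * L2_inner x (u i)) - complex_of_real q * L2_inner x (u i)"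
      unfolding L2_inner_diff_left[OF r x u_L2] regularized_coefficient[OF y \<alpha>] q g_def[symmetric]
      by (simp add: algebra_simps)
    then show ?thesis
      unfolding g_def[symmetric] q_def[symmetric]
      using norm_triangle_ineq4[of "complex_of_real g * (L2_inner y (v i) - \<kappa> i * L2_inner x (u i))"
          "complex_of_real q * L2_inner x (u i)"] gq
      by (simp add: norm_mult)
  qed
  from L2_set_le_add[OF J _ this n b[OF J]]
  show "L2_set (\<lambda>i. cmod (L2_inner (\<lambda>t. regularized u v \<kappa> \<alpha> y t - x t) (u i))) J
      \<le> sqrt B * \<delta> / sqrt \<alpha> + b"
    by simp
qed

lemma source_weight:
  "inverse (((\<kappa> i)\<^sup>2) powr (p / 2)) = (\<kappa> i powr (- (p / 2)))\<^sup>2"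
proof -
  have "(\<kappa> i)\<^sup>2 powr (p / 2) = (\<kappa> i powr (p / 2))\<^sup>2"
    using \<kappa>_pos[of i] by (simp add: power2_eq_square powr_mult)
  then show ?thesis by (simp add: powr_minus power_inverse)
qed

lemma source_set_L2_set:
  assumes "x \<in> source_set u \<kappa> (\<lambda>\<mu>. \<mu> powr (p / 2)) E" "0 \<le> E" "finite J"
  shows "L2_set (\<lambda>i. \<kappa> i powr (- (p / 2)) * cmod (L2_inner x (u i))) J \<le> E"
proof -
  have "(\<Sum>i\<in>J. inverse ((\<kappa> i)\<^sup>2 powr (p / 2)) * (cmod (L2_inner x (u i)))\<^sup>2)
      \<le> (\<Sum>\<^sub>\<infinity>i. inverse ((\<kappa> i)\<^sup>2 powr (p / 2)) * (cmod (L2_inner x (u i)))\<^sup>2)"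
    using assms by (intro finite_sum_le_infsum) (auto simp: source_set_def)
  also have "\<dots> \<le> E\<^sup>2" using assms by (simp add: source_set_def)
  finally have "sqrt (\<Sum>i\<in>J. inverse ((\<kappa> i)\<^sup>2 powr (p / 2)) * (cmod (L2_inner x (u i)))\<^sup>2) \<le> E"
    using assms(2) by (intro real_le_lsqrt) (auto intro: sum_nonneg)
  then show ?thesis by (simp add: L2_set_def source_weight power_mult_distrib)
qed

text \<open>The filter inequality \<open>\<alpha> \<kappa>^s \<le> \<alpha>^(s/2) (\<alpha> + \<kappa>\<^sup>2)\<close> holds for exponents up to
  \<open>s = 2\<close>. It is used with \<open>s = p/2\<close> for the error itself and with \<open>s = 1 + p/2\<close> for the
  residual, which is why the two parameter choices saturate at different smoothness.\<close>

lemma filtered_source_L2_set: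
  assumes x: "x \<in> source_set u \<kappa> (\<lambda>\<mu>. \<mu> powr (p / 2)) E" and E: "0 \<le> E" and J: "finite J"
    and \<alpha>: "0 < \<alpha>" and r: "0 \<le> r + p / 2" "r + p / 2 \<le> 2"
  shows "L2_set (\<lambda>i. \<alpha> / (\<alpha> + (\<kappa> i)\<^sup>2) * \<kappa> i powr r * cmod (L2_inner x (u i))) J
    \<le> \<alpha> powr (r / 2 + p / 4) * E"
proof (rule L2_set_le_scaled[OF _ _ _ source_set_L2_set[OF x E J]])
  fix i
  have k: "0 < \<kappa> i" by (rule \<kappa>_pos)
  then have d: "0 < \<alpha> + (\<kappa> i)\<^sup>2" using \<alpha> by (simp add: add_pos_pos)
  have "(\<kappa> i)\<^sup>2 powr (r / 2 + p / 4) = \<kappa> i powr (r + p / 2)"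
    using k by (simp add: power2_eq_square powr_mult flip: powr_add)
  then have "\<alpha> * \<kappa> i powr (r + p / 2) \<le> \<alpha> powr (r / 2 + p / 4) * (\<alpha> + (\<kappa> i)\<^sup>2)"
    using filter_powr_bound[of \<alpha> "(\<kappa> i)\<^sup>2" "r / 2 + p / 4"] \<alpha> k r by simp
  then have "\<alpha> / (\<alpha> + (\<kappa> i)\<^sup>2) * \<kappa> i powr (r + p / 2) \<le> \<alpha> powr (r / 2 + p / 4)"
    using d by (simp add: divide_le_eq)
  then have "\<alpha> / (\<alpha> + (\<kappa> i)\<^sup>2) * \<kappa> i powr (r + p / 2) * (\<kappa> i powr (- (p / 2)) * cmod (L2_inner x (u i)))
      \<le> \<alpha> powr (r / 2 + p / 4) * (\<kappa> i powr (- (p / 2)) * cmod (L2_inner x (u i)))"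
    by (intro mult_right_mono) auto
  moreover have "\<kappa> i powr (r + p / 2) * \<kappa> i powr (- (p / 2)) = \<kappa> i powr r"
    by (simp flip: powr_add)
  ultimately show "\<alpha> / (\<alpha> + (\<kappa> i)\<^sup>2) * \<kappa> i powr r * cmod (L2_inner x (u i))
      \<le> \<alpha> powr (r / 2 + p / 4) * (\<kappa> i powr (- (p / 2)) * cmod (L2_inner x (u i)))"
    by (simp add: mult.assoc[symmetric]) (simp add: mult.assoc)
qed (use \<alpha> \<kappa>_pos in \<open>auto simp: add_nonneg_nonneg less_imp_le\<close>)

lemma morozov_L2_set:
  assumes y: "y \<in> L2" and \<alpha>: "0 < \<alpha>" and m: "morozov_equation K u v \<kappa> B \<tau> \<delta> y \<alpha>"
  shows "finite J \<Longrightarrow> L2_set (\<lambda>i. \<alpha> / (\<alpha> + (\<kappa> i)\<^sup>2) * cmod (L2_inner y (v i))) J \<le> \<tau> * sqrt B * \<delta>"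
    and "(\<And>J. finite J \<Longrightarrow> L2_set (\<lambda>i. \<alpha> / (\<alpha> + (\<kappa> i)\<^sup>2) * cmod (L2_inner y (v i))) J \<le> b)
      \<Longrightarrow> \<tau> * sqrt B * \<delta> \<le> b"
proof -
  define R where "R i = \<alpha> / (\<alpha> + (\<kappa> i)\<^sup>2) * cmod (L2_inner y (v i))" for i
  have "cmod (L2_inner (\<lambda>x. K (regularized u v \<kappa> \<alpha> y) x - y x) (v i)) = R i" for i
  proof -
    have d: "0 < \<alpha> + (\<kappa> i)\<^sup>2" using \<alpha> by (simp add: add_pos_nonneg)
    have "\<kappa> i * (\<kappa> i / (\<alpha> + (\<kappa> i)\<^sup>2)) - 1 = - (\<alpha> / (\<alpha> + (\<kappa> i)\<^sup>2))"
      using d by (simp add: power2_eq_square field_simps)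
    then have c: "complex_of_real (\<kappa> i) * complex_of_real (\<kappa> i / (\<alpha> + (\<kappa> i)\<^sup>2)) - 1
        = - complex_of_real (\<alpha> / (\<alpha> + (\<kappa> i)\<^sup>2))"
      by (metis of_real_1 of_real_diff of_real_minus of_real_mult)
    have *: "L2_inner (\<lambda>x. K (regularized u v \<kappa> \<alpha> y) x - y x) (v i)
        = (complex_of_real (\<kappa> i) * complex_of_real (\<kappa> i / (\<alpha> + (\<kappa> i)\<^sup>2)) - 1) * L2_inner y (v i)"
      unfolding L2_inner_diff_left[OF K_L2[OF regularized_L2[OF y \<alpha>]] y v_L2]
        K_coefficient[OF regularized_L2[OF y \<alpha>]] regularized_coefficient[OF y \<alpha>]
      by (simp add: left_diff_distrib mult.assoc)
    have q: "0 \<le> \<alpha> / (\<alpha> + (\<kappa> i)\<^sup>2)" using \<alpha> d by simp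
    show ?thesis
      unfolding * c R_def norm_mult norm_minus_cancel norm_of_real abs_of_nonneg[OF q] by (rule refl)
  qed
  then have sm: "(\<lambda>i. (R i)\<^sup>2) summable_on UNIV" and eq: "sqrt (\<Sum>\<^sub>\<infinity>i. (R i)\<^sup>2) = \<tau> * sqrt B * \<delta>"
    using m by (simp_all add: morozov_equation_def Let_def)
  show "L2_set (\<lambda>i. \<alpha> / (\<alpha> + (\<kappa> i)\<^sup>2) * cmod (L2_inner y (v i))) J \<le> \<tau> * sqrt B * \<delta>" if "finite J"
    unfolding R_def[symmetric] L2_set_def eq[symmetric]
    using finite_sum_le_infsum[OF sm that] by simp
  assume b: "\<And>J. finite J \<Longrightarrow> L2_set (\<lambda>i. \<alpha> / (\<alpha> + (\<kappa> i)\<^sup>2) * cmod (L2_inner y (v i))) J \<le> b"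
  have b0: "0 \<le> b" using b[of "{}"] by simp
  have "(\<Sum>i\<in>J. (R i)\<^sup>2) \<le> b\<^sup>2" if "finite J" for J
    using power_mono[OF b[OF that, folded R_def] L2_set_nonneg, of 2]
    by (simp add: L2_set_def sum_nonneg)
  then have "(\<Sum>\<^sub>\<infinity>i. (R i)\<^sup>2) \<le> b\<^sup>2"
    using sm by (intro infsum_le_finite_sums)
  then show "\<tau> * sqrt B * \<delta> \<le> b"
    unfolding eq[symmetric] using b0 real_le_lsqrt infsum_nonneg[of UNIV "\<lambda>i. (R i)\<^sup>2"] by simp
qed

lemma apriori_error:
  assumes p: "0 < p" "p \<le> 4" and E: "0 < E" and \<mu>: "0 < \<mu>"
    and x: "x \<in> source_set u \<kappa> (\<lambda>\<mu>. \<mu> powr (p / 2)) E" and y: "y \<in> L2"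
    and noise: "L2_norm (\<lambda>t. y t - K x t) \<le> \<delta>"
  shows "L2_norm (\<lambda>t. regularized u v \<kappa> (\<mu>\<^sup>2) y t - x t) \<le> sqrt B * (\<delta> / \<mu>) + \<mu> powr (p / 2) * E"
proof -
  have "(\<mu>\<^sup>2) powr (p / 4) = \<mu> powr (p / 2)"
    using \<mu> by (simp add: power2_eq_square powr_mult flip: powr_add)
  then have "L2_set (\<lambda>i. \<mu>\<^sup>2 / (\<mu>\<^sup>2 + (\<kappa> i)\<^sup>2) * cmod (L2_inner x (u i))) J \<le> \<mu> powr (p / 2) * E"
    if "finite J" for J
    using filtered_source_L2_set[OF x _ that, of "\<mu>\<^sup>2" 0] \<kappa>_pos E \<mu> p by (simp add: less_imp_neq[THEN not_sym])
  then have "L2_norm (\<lambda>t. regularized u v \<kappa> (\<mu>\<^sup>2) y t - x t)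
      \<le> sqrt B * \<delta> / sqrt (\<mu>\<^sup>2) + \<mu> powr (p / 2) * E"
    using x \<mu> by (intro regularized_error_le y noise) (auto simp: source_set_def)
  then show ?thesis using \<mu> by simp
qed

text \<open>Of the residual \<open>\<tau> * sqrt B * \<delta>\<close> at most \<open>sqrt B * \<delta>\<close> can come from the noise. The rest is the filtered
  exact data, which is small for small \<open>\<alpha>\<close>.\<close>

lemma morozov_parameter_lower:
  assumes p: "0 < p" "p \<le> 2" and E: "0 < E" and \<delta>: "0 < \<delta>" and \<tau>: "1 < \<tau>" and \<alpha>: "0 < \<alpha>"
    and x: "x \<in> source_set u \<kappa> (\<lambda>\<mu>. \<mu> powr (p / 2)) E" and y: "y \<in> L2"
    and noise: "L2_norm (\<lambda>t. y t - K x t) \<le> \<delta>"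
    and m: "morozov_equation K u v \<kappa> B \<tau> \<delta> y \<alpha>"
  shows "(\<tau> - 1) * sqrt B * \<delta> \<le> \<alpha> powr (1 / 2 + p / 4) * E"
proof -
  have xL: "x \<in> L2" using x by (simp add: source_set_def)
  let ?n = "\<lambda>i. cmod (L2_inner y (v i) - \<kappa> i * L2_inner x (u i))"
  have "L2_set (\<lambda>i. \<alpha> / (\<alpha> + (\<kappa> i)\<^sup>2) * cmod (L2_inner y (v i))) J
      \<le> sqrt B * \<delta> + \<alpha> powr (1 / 2 + p / 4) * E" if J: "finite J" for J
  proof (rule L2_set_le_add[OF J _ _ noise_L2_set[OF xL y noise J]])
    show "L2_set (\<lambda>i. \<alpha> / (\<alpha> + (\<kappa> i)\<^sup>2) * \<kappa> i powr 1 * cmod (L2_inner x (u i))) J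
        \<le> \<alpha> powr (1 / 2 + p / 4) * E"
      using p E by (intro filtered_source_L2_set[OF x _ J \<alpha>]) auto
    fix i
    define q where "q = \<alpha> / (\<alpha> + (\<kappa> i)\<^sup>2)"
    have q: "0 \<le> q" "q \<le> 1" using \<alpha> by (auto simp: q_def divide_le_eq_1 add_pos_nonneg)
    show "0 \<le> \<alpha> / (\<alpha> + (\<kappa> i)\<^sup>2) * cmod (L2_inner y (v i))"
      by (intro mult_nonneg_nonneg norm_ge_zero q[unfolded q_def])
    have "cmod (L2_inner y (v i)) \<le> ?n i + \<kappa> i * cmod (L2_inner x (u i))"
      using norm_triangle_sub[of "L2_inner y (v i)" "\<kappa> i * L2_inner x (u i)"] \<kappa>_pos[of i]
      by (simp add: norm_mult)
    then have "q * cmod (L2_inner y (v i)) \<le> q * (?n i + \<kappa> i * cmod (L2_inner x (u i)))"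
      using q by (intro mult_left_mono)
    also have "\<dots> = q * ?n i + q * \<kappa> i * cmod (L2_inner x (u i))"
      by (simp only: distrib_left mult.assoc)
    also have "q * ?n i \<le> ?n i"
      using q by (intro mult_left_le_one_le) auto
    finally show "\<alpha> / (\<alpha> + (\<kappa> i)\<^sup>2) * cmod (L2_inner y (v i))
        \<le> ?n i + \<alpha> / (\<alpha> + (\<kappa> i)\<^sup>2) * \<kappa> i powr 1 * cmod (L2_inner x (u i))"
      using \<kappa>_pos[of i] by (simp add: q_def)
  qed
  from morozov_L2_set(2)[OF y \<alpha> m this] show ?thesis by (simp add: algebra_simps)
qed

text \<open>The bias \<open>e\<close> is controlled twice: \<open>\<kappa> i * e i\<close> by the residual and the noise, and
  \<open>\<kappa> i powr (- p / 2) * e i\<close> by the source condition. The interpolation weights combine the two.\<close>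

lemma morozov_error:
  assumes p: "0 < p" "p \<le> 2" and E: "0 < E" and \<delta>: "0 < \<delta>" and \<tau>: "1 < \<tau>" and \<alpha>: "0 < \<alpha>"
    and \<mu>: "0 < \<mu>"
    and x: "x \<in> source_set u \<kappa> (\<lambda>\<mu>. \<mu> powr (p / 2)) E" and y: "y \<in> L2"
    and noise: "L2_norm (\<lambda>t. y t - K x t) \<le> \<delta>"
    and m: "morozov_equation K u v \<kappa> B \<tau> \<delta> y \<alpha>"
  shows "L2_norm (\<lambda>t. regularized u v \<kappa> \<alpha> y t - x t)
    \<le> sqrt B * \<delta> / sqrt \<alpha> + ((\<tau> + 1) * sqrt B * (\<delta> / \<mu>) + \<mu> powr (p / 2) * E)"
proof -
  have xL: "x \<in> L2" using x by (simp add: source_set_def)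
  let ?n = "\<lambda>i. cmod (L2_inner y (v i) - \<kappa> i * L2_inner x (u i))"
  have "L2_set (\<lambda>i. \<alpha> / (\<alpha> + (\<kappa> i)\<^sup>2) * cmod (L2_inner x (u i))) J
      \<le> 1 / \<mu> * (\<tau> * sqrt B * \<delta> + sqrt B * \<delta>) + \<mu> powr (p / 2) * E" if J: "finite J" for J
  proof (rule L2_set_le_add[OF J])
    define e where "e i = \<alpha> / (\<alpha> + (\<kappa> i)\<^sup>2) * cmod (L2_inner x (u i))" for i
    have q: "0 \<le> \<alpha> / (\<alpha> + (\<kappa> i)\<^sup>2)" "\<alpha> / (\<alpha> + (\<kappa> i)\<^sup>2) \<le> 1" for i
      using \<alpha> by (auto simp: divide_le_eq_1 add_pos_nonneg)
    have e0: "0 \<le> e i" for i unfolding e_def by (intro mult_nonneg_nonneg norm_ge_zero q)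
    have "L2_set (\<lambda>i. \<kappa> i * e i) J \<le> \<tau> * sqrt B * \<delta> + sqrt B * \<delta>"
    proof (rule L2_set_le_add[OF J _ _ morozov_L2_set(1)[OF y \<alpha> m J] noise_L2_set[OF xL y noise J]])
      fix i
      show "0 \<le> \<kappa> i * e i" using e0[of i] \<kappa>_pos[of i] by simp
      define q where "q = \<alpha> / (\<alpha> + (\<kappa> i)\<^sup>2)"
      have q: "0 \<le> q" "q \<le> 1" using q[of i] by (auto simp: q_def)
      have "\<kappa> i * cmod (L2_inner x (u i)) \<le> cmod (L2_inner y (v i)) + ?n i"
        using norm_triangle_sub[of "\<kappa> i * L2_inner x (u i)" "L2_inner y (v i)"] \<kappa>_pos[of i]
        by (simp add: norm_mult norm_minus_commute)
      then have "q * (\<kappa> i * cmod (L2_inner x (u i))) \<le> q * (cmod (L2_inner y (v i)) + ?n i)"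
        using q by (intro mult_left_mono)
      also have "\<dots> = q * cmod (L2_inner y (v i)) + q * ?n i" by (rule distrib_left)
      also have "q * ?n i \<le> ?n i" using q by (intro mult_left_le_one_le) auto
      finally show "\<kappa> i * e i \<le> \<alpha> / (\<alpha> + (\<kappa> i)\<^sup>2) * cmod (L2_inner y (v i)) + ?n i"
        by (simp add: e_def q_def mult.left_commute)
    qed
    from L2_set_le_scaled[OF _ _ _ this, of "1 / \<mu>" "\<lambda>i. \<kappa> i / \<mu> * e i"]
    show "L2_set (\<lambda>i. \<kappa> i / \<mu> * e i) J \<le> 1 / \<mu> * (\<tau> * sqrt B * \<delta> + sqrt B * \<delta>)"
      using \<mu> \<kappa>_pos e0 by (simp add: less_imp_le)
    have "L2_set (\<lambda>i. \<mu> powr (p / 2) * \<kappa> i powr (- (p / 2)) * e i) J \<le> \<mu> powr (p / 2) * E"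
    proof (rule L2_set_le_scaled[OF _ _ _ source_set_L2_set[OF x _ J]])
      fix i
      have "e i \<le> cmod (L2_inner x (u i))"
        unfolding e_def using q[of i] by (intro mult_left_le_one_le) auto
      then show "\<mu> powr (p / 2) * \<kappa> i powr (- (p / 2)) * e i
          \<le> \<mu> powr (p / 2) * (\<kappa> i powr (- (p / 2)) * cmod (L2_inner x (u i)))"
        unfolding mult.assoc by (intro mult_left_mono) auto
    qed (use E e0 in auto)
    then show "L2_set (\<lambda>i. \<mu> powr (p / 2) * \<kappa> i powr (- (p / 2)) * e i) J \<le> \<mu> powr (p / 2) * E" .
    fix i
    show "0 \<le> \<alpha> / (\<alpha> + (\<kappa> i)\<^sup>2) * cmod (L2_inner x (u i))" using e0[of i] by (simp only: e_def)
    have "1 * e i \<le> (\<kappa> i / \<mu> + \<mu> powr (p / 2) * \<kappa> i powr (- (p / 2))) * e i"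
      using p by (intro mult_right_mono interpolation_weights \<kappa>_pos \<mu> e0) auto
    then show "\<alpha> / (\<alpha> + (\<kappa> i)\<^sup>2) * cmod (L2_inner x (u i))
        \<le> \<kappa> i / \<mu> * e i + \<mu> powr (p / 2) * \<kappa> i powr (- (p / 2)) * e i"
      unfolding e_def[symmetric] by (simp only: distrib_right mult_1)
  qed
  from regularized_error_le[OF xL y noise \<alpha> this] show ?thesis by (simp add: algebra_simps add_divide_distrib)
qed

lemma apriori_rate:
  assumes p: "0 < p" "p \<le> 4" and E: "0 < E" and \<delta>: "0 < \<delta>"
    and x: "x \<in> source_set u \<kappa> (\<lambda>\<mu>. \<mu> powr (p / 2)) E" and y: "y \<in> L2"
    and noise: "L2_norm (\<lambda>t. y t - K x t) \<le> \<delta>"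
  shows "L2_norm (\<lambda>t. regularized u v \<kappa> ((\<delta> / E) powr (4 / (p + 2))) y t - x t)
    \<le> (sqrt B + 1) * \<delta> powr (p / (p + 2)) * E powr (2 / (p + 2))"
proof -
  define \<mu> where "\<mu> = (\<delta> / E) powr (2 / (p + 2))"
  note bal = balance_scale[OF p(1) E \<delta>, folded \<mu>_def]
  have \<mu>: "0 < \<mu>" using \<delta> E by (simp add: \<mu>_def)
  have "2 / (p + 2) + 2 / (p + 2) = 4 / (p + 2)" by (simp flip: add_divide_distrib)
  then have "(\<delta> / E) powr (4 / (p + 2)) = \<mu>\<^sup>2"
    unfolding \<mu>_def power2_eq_square by (simp only: powr_add[symmetric])
  then show ?thesis
    using apriori_error[OF p E \<mu> x y noise] unfolding bal(1) bal(2)[symmetric]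
    by (simp add: algebra_simps)
qed

text \<open>The lower bound for \<open>\<alpha>\<close> raised to the power \<open>2 / (p + 2)\<close> says that \<open>sqrt \<alpha>\<close> is at least
  a multiple of the balancing scale, so the noise is amplified by at most a constant factor more than at the
  balancing scale.\<close>

lemma morozov_rate:
  assumes p: "0 < p" "p \<le> 2" and E: "0 < E" and \<delta>: "0 < \<delta>" and \<tau>: "1 < \<tau>" and \<alpha>: "0 < \<alpha>"
    and x: "x \<in> source_set u \<kappa> (\<lambda>\<mu>. \<mu> powr (p / 2)) E" and y: "y \<in> L2"
    and noise: "L2_norm (\<lambda>t. y t - K x t) \<le> \<delta>"
    and m: "morozov_equation K u v \<kappa> B \<tau> \<delta> y \<alpha>"
  shows "L2_norm (\<lambda>t. regularized u v \<kappa> \<alpha> y t - x t)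
    \<le> (sqrt B / ((\<tau> - 1) * sqrt B) powr (2 / (p + 2)) + (\<tau> + 1) * sqrt B + 1)
      * \<delta> powr (p / (p + 2)) * E powr (2 / (p + 2))"
proof -
  define \<mu> where "\<mu> = (\<delta> / E) powr (2 / (p + 2))"
  define k where "k = ((\<tau> - 1) * sqrt B) powr (2 / (p + 2))"
  define \<rho> where "\<rho> = \<delta> powr (p / (p + 2)) * E powr (2 / (p + 2))"
  note bal = balance_scale[OF p(1) E \<delta>, folded \<mu>_def \<rho>_def]
  have \<mu>: "0 < \<mu>" using \<delta> E by (simp add: \<mu>_def)
  have k: "0 < k" using \<tau> B_pos by (simp add: k_def)
  have "((\<tau> - 1) * sqrt B) * (\<delta> / E) \<le> \<alpha> powr (1 / 2 + p / 4)"
    using morozov_parameter_lower[OF p E \<delta> \<tau> \<alpha> x y noise m] E by (simp add: pos_divide_le_eq)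
  then have "(((\<tau> - 1) * sqrt B) * (\<delta> / E)) powr (2 / (p + 2))
      \<le> (\<alpha> powr (1 / 2 + p / 4)) powr (2 / (p + 2))"
    using p \<tau> B_pos \<delta> E by (intro powr_mono2) auto
  also have "(((\<tau> - 1) * sqrt B) * (\<delta> / E)) powr (2 / (p + 2)) = k * \<mu>"
    unfolding k_def \<mu>_def by (rule powr_mult)
  also have "(1 / 2 + p / 4) * (2 / (p + 2)) = 1 / 2" using p by (simp add: field_simps)
  then have "(\<alpha> powr (1 / 2 + p / 4)) powr (2 / (p + 2)) = sqrt \<alpha>"
    using \<alpha> by (simp only: powr_powr powr_half_sqrt less_imp_le)
  finally have "k * \<mu> \<le> sqrt \<alpha>" .
  then have "sqrt B * \<delta> / sqrt \<alpha> \<le> sqrt B * \<delta> / (k * \<mu>)"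
    using k \<mu> B_pos \<delta> \<alpha> by (intro divide_left_mono) auto
  also have "\<dots> = sqrt B / k * (\<delta> / \<mu>)" by simp
  finally have "sqrt B * \<delta> / sqrt \<alpha> \<le> sqrt B / k * \<rho>" unfolding bal(1) .
  then have "L2_norm (\<lambda>t. regularized u v \<kappa> \<alpha> y t - x t)
      \<le> sqrt B / k * \<rho> + ((\<tau> + 1) * sqrt B * \<rho> + \<rho>)"
    using morozov_error[OF p E \<delta> \<tau> \<alpha> \<mu> x y noise m] unfolding bal(1) bal(2)[symmetric] by linarith
  also have "\<dots> = (sqrt B / k + (\<tau> + 1) * sqrt B + 1) * \<rho>" by (simp add: algebra_simps)
  finally show ?thesis by (simp only: \<rho>_def k_def mult.assoc)
qed

section \<open>Order optimality\<close>

lemma scaled_basis_in_source_set: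
  assumes c: "cmod c \<le> \<kappa> i powr (p / 2) * E"
  shows "(\<lambda>t. c * u i t) \<in> source_set u \<kappa> (\<lambda>\<mu>. \<mu> powr (p / 2)) E"
proof -
  let ?w = "\<lambda>j. inverse ((\<kappa> j)\<^sup>2 powr (p / 2)) * (cmod (L2_inner (\<lambda>t. c * u i t) (u j)))\<^sup>2"
  let ?d = "\<lambda>j. if j = i then (\<kappa> i powr (- (p / 2)) * cmod c)\<^sup>2 else 0"
  have eq: "?w = ?d"
    by (auto simp: fun_eq_iff source_weight L2_inner_scale_left orthonormal_basis_inner[OF onb]
        power_mult_distrib)
  have "(?d has_sum (\<kappa> i powr (- (p / 2)) * cmod c)\<^sup>2) UNIV"
    using has_sum_finite[of "{i}" ?d] by (subst has_sum_cong_neutral[where T = "{i}"]) auto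
  then have sm: "?w summable_on UNIV" and s: "(\<Sum>\<^sub>\<infinity>j. ?w j) = (\<kappa> i powr (- (p / 2)) * cmod c)\<^sup>2"
    unfolding eq by (auto simp: summable_on_def infsumI)
  have "\<kappa> i powr (- (p / 2)) * cmod c \<le> \<kappa> i powr (- (p / 2)) * (\<kappa> i powr (p / 2) * E)"
    by (intro mult_left_mono c) simp
  also have "\<dots> = E" using \<kappa>_pos[of i] by (simp add: mult.assoc[symmetric] flip: powr_add)
  finally have "(\<kappa> i powr (- (p / 2)) * cmod c)\<^sup>2 \<le> E\<^sup>2"
    by (intro power_mono) auto
  then show ?thesis
    unfolding source_set_def using sm s L2_scale[OF u_L2, of c i] by simp
qed

lemma K_scaled_basis_norm:
  "sqrt A * L2_norm (K (\<lambda>t. c * u i t)) \<le> \<kappa> i * cmod c"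
proof -
  let ?d = "\<lambda>j. if j = i then (\<kappa> i * cmod c)\<^sup>2 else 0"
  have L: "(\<lambda>t. c * u i t) \<in> L2" by (rule L2_scale[OF u_L2])
  have eq: "(\<lambda>j. (cmod (L2_inner (K (\<lambda>t. c * u i t)) (v j)))\<^sup>2) = ?d"
    by (auto simp: fun_eq_iff K_coefficient[OF L] L2_inner_scale_left orthonormal_basis_inner[OF onb]
        norm_mult power_mult_distrib)
  have "(?d has_sum (\<kappa> i * cmod c)\<^sup>2) UNIV"
    using has_sum_finite[of "{i}" ?d] by (subst has_sum_cong_neutral[where T = "{i}"]) auto
  then have "A * (L2_norm (K (\<lambda>t. c * u i t)))\<^sup>2 \<le> (\<kappa> i * cmod c)\<^sup>2"
    using K_lower[OF L] unfolding eq by (simp add: infsumI)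
  then have "(sqrt A * L2_norm (K (\<lambda>t. c * u i t)))\<^sup>2 \<le> (\<kappa> i * cmod c)\<^sup>2"
    using A_pos by (simp add: power_mult_distrib)
  then show ?thesis
    by (rule power2_le_imp_le) (simp add: \<kappa>_pos less_imp_le)
qed

text \<open>The elements \<open>c u i\<close> and \<open>- c u i\<close> of the source set cannot be told apart from the data \<open>0\<close>, and
  their distance is \<open>2 * c\<close>.\<close>

lemma worst_case_error_lower:
  assumes S: "L2_map S" and c: "0 \<le> c" "c \<le> \<kappa> i powr (p / 2) * E" "\<kappa> i * c \<le> sqrt A * \<delta>"
  shows "ennreal c \<le> worst_case_error K L2 (source_set u \<kappa> (\<lambda>\<mu>. \<mu> powr (p / 2)) E) \<delta> S"
    (is "_ \<le> ?W")
proof -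
  define x where "x s t = complex_of_real (s * c) * u i t" for s :: real and t
  have W: "ennreal (L2_norm (\<lambda>t. S (\<lambda>t. 0) t - x s t)) \<le> ?W" if s: "\<bar>s\<bar> = 1" for s
  proof -
    have n: "cmod (complex_of_real (s * c)) = c" using s c by (simp add: abs_mult del: of_real_mult)
    have M: "x s \<in> source_set u \<kappa> (\<lambda>\<mu>. \<mu> powr (p / 2)) E"
      unfolding x_def[abs_def] by (rule scaled_basis_in_source_set) (use n c in simp)
    have "sqrt A * L2_norm (K (x s)) \<le> sqrt A * \<delta>"
      using K_scaled_basis_norm[of "complex_of_real (s * c)" i] c(3)
      unfolding x_def[abs_def] n by linarith
    then have "L2_norm (K (x s)) \<le> \<delta>" using A_pos by simp
    then have "(x s, \<lambda>t. 0) \<in> {(x, y). x \<in> source_set u \<kappa> (\<lambda>\<mu>. \<mu> powr (p / 2)) E \<and> y \<in> L2 \<and>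
        L2_norm (\<lambda>t. K x t - y t) \<le> \<delta>}"
      using M L2_zero by simp
    then show ?thesis
      unfolding worst_case_error_def by (rule SUP_upper2) simp
  qed
  have S0: "S (\<lambda>t. 0) \<in> L2" using S L2_zero by (auto simp: L2_map_def)
  have xL: "x s \<in> L2" for s unfolding x_def[abs_def] by (rule L2_scale[OF u_L2])
  have "2 * c = L2_norm (\<lambda>t. x 1 t - x (- 1) t)"
  proof -
    have "(\<lambda>t. x 1 t - x (- 1) t) = (\<lambda>t. complex_of_real (2 * c) * u i t)"
      by (simp add: x_def fun_eq_iff)
    moreover have "(L2_norm (u i))\<^sup>2 = 1"
      using L2_inner_self[of "u i"] orthonormal_basis_inner[OF onb, of i i]
      by (metis of_real_1 of_real_eq_iff)
    then have "L2_norm (u i) = 1"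
      using L2_norm_nonneg[of "u i"] by (simp add: power2_eq_1_iff)
    ultimately show ?thesis
      using c(1) by (simp only: L2_norm_scale norm_of_real)
  qed
  also have "\<dots> \<le> L2_norm (\<lambda>t. x 1 t - S (\<lambda>t. 0) t) + L2_norm (\<lambda>t. S (\<lambda>t. 0) t - x (- 1) t)"
    by (rule L2_norm_diff_triangle[OF xL S0 xL])
  finally have "c \<le> L2_norm (\<lambda>t. S (\<lambda>t. 0) t - x 1 t) \<or> c \<le> L2_norm (\<lambda>t. S (\<lambda>t. 0) t - x (- 1) t)"
    unfolding L2_norm_minus_commute[of "x 1"] by linarith
  then show ?thesis
    using W[of 1] W[of "- 1"] by (auto intro: order_trans[OF ennreal_leI])
qed

text \<open>The lower bound needs a value of \<open>\<kappa>\<close> comparable to the balancing scale \<open>\<mu>\<close>. For \<open>\<delta> < E\<close> this scale is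
  below 1, where the first assumption provides one.\<close>

lemma uniform_order_optimalI:
  assumes \<kappa>_dense: "\<And>\<mu>. 0 < \<mu> \<Longrightarrow> \<mu> < 1 \<Longrightarrow> \<exists>i. \<kappa> i \<le> \<mu> \<and> \<mu> \<le> 4 * \<kappa> i"
    and p: "0 < p" and E: "0 < E" and C: "0 < C"
    and RL: "\<And>\<delta> y. 0 < \<delta> \<Longrightarrow> y \<in> D \<delta> \<Longrightarrow> R \<delta> y \<in> L2"
    and err: "\<And>\<delta> x y. 0 < \<delta> \<Longrightarrow> x \<in> source_set u \<kappa> (\<lambda>\<mu>. \<mu> powr (p / 2)) E \<Longrightarrow> y \<in> D \<delta> \<Longrightarrow>
      L2_norm (\<lambda>t. y t - K x t) \<le> \<delta> \<Longrightarrow>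
      L2_norm (\<lambda>t. R \<delta> y t - x t) \<le> C * \<delta> powr (p / (p + 2)) * E powr (2 / (p + 2))"
  shows "uniform_order_optimal K D (source_set u \<kappa> (\<lambda>\<mu>. \<mu> powr (p / 2)) E) R"
proof -
  let ?M = "source_set u \<kappa> (\<lambda>\<mu>. \<mu> powr (p / 2)) E"
  \<comment> \<open>The first factor allows for \<open>\<kappa> i \<ge> \<mu> / 4\<close> in the source condition, the second is the frame
    bound that turns coefficients of \<open>K x\<close> into its norm.\<close>
  define c0 where "c0 = min (4 powr (- (p / 2))) (sqrt A)"
  have c0: "0 < c0" using A_pos by (simp add: c0_def)
  have "worst_case_error K (D \<delta>) ?M \<delta> (R \<delta>)
      \<le> ennreal (C / c0) * (INF S\<in>{S. L2_map S}. worst_case_error K L2 ?M \<delta> S)"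
    if \<delta>: "0 < \<delta>" "\<delta> < E" for \<delta>
  proof -
    define \<rho> where "\<rho> = \<delta> powr (p / (p + 2)) * E powr (2 / (p + 2))"
    define \<mu> where "\<mu> = (\<delta> / E) powr (2 / (p + 2))"
    have \<rho>: "0 < \<rho>" using \<delta> E by (simp add: \<rho>_def)
    note bal = balance_scale[OF p E \<delta>(1), folded \<rho>_def \<mu>_def]
    have \<mu>: "0 < \<mu>" "\<mu> < 1"
      using \<delta> E p powr_less_mono2[of "2 / (p + 2)" "\<delta> / E" 1] by (simp_all add: \<mu>_def)
    obtain i where i: "\<kappa> i \<le> \<mu>" "\<mu> \<le> 4 * \<kappa> i" using \<kappa>_dense[OF \<mu>] by blast
    have low: "ennreal (c0 * \<rho>) \<le> worst_case_error K L2 ?M \<delta> S" if "L2_map S" for S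
    proof (rule worst_case_error_lower[OF that])
      show "0 \<le> c0 * \<rho>" using c0 \<rho> by simp
      have "4 powr (- (p / 2)) * \<mu> powr (p / 2) = (\<mu> / 4) powr (p / 2)"
        using \<mu> by (simp add: powr_minus powr_divide field_simps)
      also have "\<dots> \<le> \<kappa> i powr (p / 2)" using i \<mu> p by (intro powr_mono2) auto
      finally have k: "4 powr (- (p / 2)) * \<mu> powr (p / 2) \<le> \<kappa> i powr (p / 2)" .
      have "c0 * \<rho> \<le> 4 powr (- (p / 2)) * \<rho>" using \<rho> by (intro mult_right_mono) (auto simp: c0_def)
      also have "\<dots> = (4 powr (- (p / 2)) * \<mu> powr (p / 2)) * E" by (simp add: bal(2))
      also have "\<dots> \<le> \<kappa> i powr (p / 2) * E" using k E by (intro mult_right_mono) auto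
      finally show "c0 * \<rho> \<le> \<kappa> i powr (p / 2) * E" .
      have "\<kappa> i * (c0 * \<rho>) \<le> \<mu> * (sqrt A * \<rho>)"
        using i(1) \<mu> \<rho> c0 A_pos by (intro mult_mono mult_right_mono) (auto simp: c0_def)
      also have "\<dots> = sqrt A * (\<mu> * \<rho>)" by simp
      also have "\<mu> * \<rho> = \<delta>" unfolding bal(1)[symmetric] using \<mu> by simp
      finally show "\<kappa> i * (c0 * \<rho>) \<le> sqrt A * \<delta>" .
    qed
    have "worst_case_error K (D \<delta>) ?M \<delta> (R \<delta>) \<le> ennreal (C * \<rho>)"
      unfolding worst_case_error_def
    proof (rule SUP_least, clarsimp)
      fix x y assume "x \<in> ?M" "y \<in> D \<delta>" "L2_norm (\<lambda>t. K x t - y t) \<le> \<delta>"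
      then show "ennreal (L2_norm (\<lambda>t. R \<delta> y t - x t)) \<le> ennreal (C * \<rho>)"
        using err[OF \<delta>(1), of x y] L2_norm_minus_commute[of "K x" y]
        by (intro ennreal_leI) (simp add: \<rho>_def mult.assoc)
    qed
    also have "ennreal (C * \<rho>) = ennreal (C / c0) * ennreal (c0 * \<rho>)"
      using C c0 \<rho> by (simp flip: ennreal_mult)
    also have "\<dots> \<le> ennreal (C / c0) * (INF S\<in>{S. L2_map S}. worst_case_error K L2 ?M \<delta> S)"
      by (intro mult_left_mono INF_greatest low) auto
    finally show ?thesis .
  qed
  then show ?thesis
    unfolding uniform_order_optimal_def using E RL C c0
    by (intro exI[of _ E] conjI exI[of _ "C / c0"] allI impI) auto
qed

end

section \<open>The wavelet decomposition of the heat operator\<close>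

lemma wavelet_kappa_pos: "0 < wavelet_kappa l"
  by (simp add: wavelet_kappa_def)

text \<open>The positive dyadic levels contribute the values \<open>4 ^ -n\<close>.\<close>

lemma wavelet_kappa_dense:
  assumes "0 < \<mu>" "\<mu> < 1"
  shows "\<exists>l. wavelet_kappa l \<le> \<mu> \<and> \<mu> \<le> 4 * wavelet_kappa l"
proof -
  define n where "n = (LEAST n. (1/4) ^ n \<le> \<mu>)"
  have "\<exists>n. (1/4) ^ n \<le> \<mu>"
    using real_arch_pow_inv[of \<mu> "1/4"] assms by (auto intro: less_imp_le)
  then have n: "(1/4) ^ n \<le> \<mu>" unfolding n_def by (rule LeastI_ex)
  with assms obtain m where m: "n = Suc m" by (cases n) auto
  have "\<mu> \<le> (1/4) ^ m"
    using not_less_Least[of m "\<lambda>n. (1/4) ^ n \<le> \<mu>"] m unfolding n_def by (simp add: n_def)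
  moreover have "wavelet_kappa (int n, 0) = (1/4) ^ n"
  proof -
    have "(2::real) powr (- 2 * real n) = (2 powr (- 2)) powr real n" by (simp only: powr_powr)
    moreover have "(2::real) powr (- 2) = 1/4" by (simp add: powr_minus)
    moreover have "(1/4::real) powr real n = (1/4) ^ n" by (rule powr_realpow) simp
    ultimately show ?thesis using m by (simp add: wavelet_kappa_def)
  qed
  ultimately show ?thesis using n m by (intro exI[of _ "(int n, 0)"]) simp
qed

theorem theorem4p2:
  fixes \<gamma> T a\<^sub>u b\<^sub>u A\<^sub>v B\<^sub>v p :: real
    and K :: "(real \<Rightarrow> complex) \<Rightarrow> (real \<Rightarrow> complex)"
    and \<psi> \<psi>hat :: "real \<Rightarrow> complex"
    and u v :: "int \<times> int \<Rightarrow> real \<Rightarrow> complex"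
    and \<kappa> :: "int \<times> int \<Rightarrow> real"
    and \<phi> :: "real \<Rightarrow> real"
  assumes "0 < \<gamma>" and "\<gamma> < 1" and "0 < T"
    and "heat_operator \<gamma> T K"
    and "0 < a\<^sub>u" and "0 < b\<^sub>u"
    and "has_L2_fourier \<psi> \<psi>hat"
    and "AE \<omega> in lborel. \<not> (a\<^sub>u \<le> \<bar>\<omega>\<bar> \<and> \<bar>\<omega>\<bar> \<le> b\<^sub>u) \<longrightarrow> \<psi>hat \<omega> = 0"
    and "u = wavelet \<psi>" and "orthonormal_basis u"
    and "\<kappa> = wavelet_kappa"
    and "\<forall>l. \<exists>g. has_L2_fourier (u l) g \<and>
           has_L2_fourier (v l)
             (\<lambda>\<omega>. complex_of_real (\<kappa> l * inverse (heat_symbol \<gamma> T \<omega>)) * g \<omega>)"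
    and "diagonal_frame_decomposition K u v \<kappa>"
    and "frame_over (L2_closed_range K) v A\<^sub>v B\<^sub>v"
    and "\<phi> = (\<lambda>\<mu>. \<mu> powr (p / 2))"
  shows
    "(0 < p \<and> p \<le> 4 \<longrightarrow>
       (\<forall>E>0. uniform_order_optimal K (\<lambda>\<delta>. L2) (source_set u \<kappa> \<phi> E)
                (\<lambda>\<delta>. regularized u v \<kappa> ((\<delta> / E) powr (4 / (p + 2))))) \<and>
       (\<exists>C>0. \<forall>E>0. \<forall>\<delta>>0. \<forall>\<theta>\<^sub>0 \<in> source_set u \<kappa> \<phi> E. \<forall>y\<in>L2.
          L2_norm (\<lambda>x. y x - K \<theta>\<^sub>0 x) \<le> \<delta> \<longrightarrow>
          L2_norm (\<lambda>x. regularized u v \<kappa> ((\<delta> / E) powr (4 / (p + 2))) y x - \<theta>\<^sub>0 x)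
            \<le> C * \<delta> powr (p / (p + 2)) * E powr (2 / (p + 2)))) \<and>
     (0 < p \<and> p \<le> 2 \<longrightarrow> (\<forall>\<tau>>1.
       (\<forall>E>0. \<forall>\<alpha>\<^sub>D :: real \<Rightarrow> (real \<Rightarrow> complex) \<Rightarrow> real.
          (\<forall>\<delta>>0. \<forall>y \<in> morozov_solvable K A\<^sub>v B\<^sub>v \<tau> \<delta>.
             0 < \<alpha>\<^sub>D \<delta> y \<and> morozov_equation K u v \<kappa> B\<^sub>v \<tau> \<delta> y (\<alpha>\<^sub>D \<delta> y)) \<longrightarrow>
          uniform_order_optimal K (morozov_solvable K A\<^sub>v B\<^sub>v \<tau>) (source_set u \<kappa> \<phi> E)
            (\<lambda>\<delta> y. regularized u v \<kappa> (\<alpha>\<^sub>D \<delta> y) y)) \<and>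
       (\<exists>C>0. \<forall>E>0. \<forall>\<delta>>0. \<forall>\<theta>\<^sub>0 \<in> source_set u \<kappa> \<phi> E. \<forall>y\<in>L2. \<forall>\<alpha>>0.
          L2_norm (\<lambda>x. y x - K \<theta>\<^sub>0 x) \<le> \<delta> \<longrightarrow>
          morozov_equation K u v \<kappa> B\<^sub>v \<tau> \<delta> y \<alpha> \<longrightarrow>
          L2_norm (\<lambda>x. regularized u v \<kappa> \<alpha> y x - \<theta>\<^sub>0 x)
            \<le> C * \<delta> powr (p / (p + 2)) * E powr (2 / (p + 2)))))"
proof -
  note K = assms(4) and dfd = assms(13) and fr = assms(14)
  have K_L2: "K f \<in> L2" if "f \<in> L2" for f
    using K that by (auto simp: heat_operator_def L2_map_def)
  have u_L2: "u l \<in> L2" for l by (rule orthonormal_basis_L2[OF assms(10)])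
  have V: "L2_closed_range K \<subseteq> L2" by (auto simp: L2_closed_range_def)
  have range: "K f \<in> L2_closed_range K" if "f \<in> L2" for f
    using that K_L2[OF that] by (auto simp: L2_closed_range_def L2_norm_def intro!: bexI[of _ f])
  interpret diagonal_system K u v \<kappa> A\<^sub>v B\<^sub>v
  proof
    show "orthonormal_basis u" by fact
    show "0 < \<kappa> l" for l using wavelet_kappa_pos by (simp add: assms(11))
    show "v l \<in> L2" for l using fr V unfolding frame_over_def by blast
    show "K f \<in> L2" if "f \<in> L2" for f by (rule K_L2[OF that])
    show "L2_inner (K f) (v l) = \<kappa> l * L2_inner f (u l)" if "f \<in> L2" for f l
      using dfd that
      by (simp add: diagonal_frame_decomposition_def L2_inner_scale_right del: split_paired_All)
    show "0 < A\<^sub>v" "0 < B\<^sub>v" using fr by (simp_all add: frame_over_def)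
    show "(\<Sum>i\<in>J. (cmod (L2_inner w (v i)))\<^sup>2) \<le> B\<^sub>v * (L2_norm w)\<^sup>2" if "w \<in> L2" "finite J" for w J
      by (rule frame_Bessel[OF V L2_closed_range_lincomb[OF K_L2 heat_operator_lincomb[OF K]] fr that])
    show "A\<^sub>v * (L2_norm (K f))\<^sup>2 \<le> (\<Sum>\<^sub>\<infinity>l. (cmod (L2_inner (K f) (v l)))\<^sup>2)" if "f \<in> L2" for f
      using fr range[OF that] by (simp add: frame_over_def)
  qed
  note opt = uniform_order_optimalI[OF wavelet_kappa_dense[folded assms(11)]]
  show ?thesis
    unfolding assms(15)
  proof (intro conjI impI allI)
    assume p: "0 < p \<and> p \<le> 4"
    show "uniform_order_optimal K (\<lambda>\<delta>. L2) (source_set u \<kappa> (\<lambda>\<mu>. \<mu> powr (p / 2)) E)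
        (\<lambda>\<delta>. regularized u v \<kappa> ((\<delta> / E) powr (4 / (p + 2))))" if E: "0 < E" for E
    proof (rule opt)
      show "0 < sqrt B\<^sub>v + 1" using B_pos by (simp add: add_pos_pos)
      show "regularized u v \<kappa> ((\<delta> / E) powr (4 / (p + 2))) y \<in> L2" if "0 < \<delta>" "y \<in> L2" for \<delta> y
        using that E by (intro regularized_L2) auto
    qed (use p E apriori_rate in auto)
    show "\<exists>C>0. \<forall>E>0. \<forall>\<delta>>0. \<forall>\<theta>\<^sub>0 \<in> source_set u \<kappa> (\<lambda>\<mu>. \<mu> powr (p / 2)) E. \<forall>y\<in>L2.
        L2_norm (\<lambda>x. y x - K \<theta>\<^sub>0 x) \<le> \<delta> \<longrightarrow>
        L2_norm (\<lambda>x. regularized u v \<kappa> ((\<delta> / E) powr (4 / (p + 2))) y x - \<theta>\<^sub>0 x)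
          \<le> C * \<delta> powr (p / (p + 2)) * E powr (2 / (p + 2))"
      using p apriori_rate B_pos by (intro exI[of _ "sqrt B\<^sub>v + 1"] conjI) (auto simp: add_pos_pos)
  next
    fix \<tau> :: real
    assume p: "0 < p \<and> p \<le> 2" and \<tau>: "1 < \<tau>"
    let ?C = "sqrt B\<^sub>v / ((\<tau> - 1) * sqrt B\<^sub>v) powr (2 / (p + 2)) + (\<tau> + 1) * sqrt B\<^sub>v + 1"
    have C: "0 < ?C" using \<tau> B_pos by (intro add_nonneg_pos add_nonneg_nonneg) auto
    show "uniform_order_optimal K (morozov_solvable K A\<^sub>v B\<^sub>v \<tau>)
        (source_set u \<kappa> (\<lambda>\<mu>. \<mu> powr (p / 2)) E) (\<lambda>\<delta> y. regularized u v \<kappa> (\<alpha>\<^sub>D \<delta> y) y)"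
      if E: "0 < E" and \<alpha>: "\<forall>\<delta>>0. \<forall>y \<in> morozov_solvable K A\<^sub>v B\<^sub>v \<tau> \<delta>.
        0 < \<alpha>\<^sub>D \<delta> y \<and> morozov_equation K u v \<kappa> B\<^sub>v \<tau> \<delta> y (\<alpha>\<^sub>D \<delta> y)"
      for E and \<alpha>\<^sub>D :: "real \<Rightarrow> (real \<Rightarrow> complex) \<Rightarrow> real"
    proof (rule opt[OF _ _ _ E C])
      have L: "y \<in> L2" if "y \<in> morozov_solvable K A\<^sub>v B\<^sub>v \<tau> \<delta>" for y \<delta>
        using that by (simp add: morozov_solvable_def)
      show "regularized u v \<kappa> (\<alpha>\<^sub>D \<delta> y) y \<in> L2"
        if "0 < \<delta>" "y \<in> morozov_solvable K A\<^sub>v B\<^sub>v \<tau> \<delta>" for \<delta> y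
        using that \<alpha> L by (intro regularized_L2) auto
      show "L2_norm (\<lambda>t. regularized u v \<kappa> (\<alpha>\<^sub>D \<delta> y) y t - x t)
          \<le> ?C * \<delta> powr (p / (p + 2)) * E powr (2 / (p + 2))"
        if "0 < \<delta>" "x \<in> source_set u \<kappa> (\<lambda>\<mu>. \<mu> powr (p / 2)) E"
          "y \<in> morozov_solvable K A\<^sub>v B\<^sub>v \<tau> \<delta>" "L2_norm (\<lambda>t. y t - K x t) \<le> \<delta>" for \<delta> x y
        using that p \<tau> E \<alpha> L by (intro morozov_rate) auto
    qed (use p in auto)
    show "\<exists>C>0. \<forall>E>0. \<forall>\<delta>>0. \<forall>\<theta>\<^sub>0 \<in> source_set u \<kappa> (\<lambda>\<mu>. \<mu> powr (p / 2)) E. \<forall>y\<in>L2. \<forall>\<alpha>>0.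
        L2_norm (\<lambda>x. y x - K \<theta>\<^sub>0 x) \<le> \<delta> \<longrightarrow>
        morozov_equation K u v \<kappa> B\<^sub>v \<tau> \<delta> y \<alpha> \<longrightarrow>
        L2_norm (\<lambda>x. regularized u v \<kappa> \<alpha> y x - \<theta>\<^sub>0 x)
          \<le> C * \<delta> powr (p / (p + 2)) * E powr (2 / (p + 2))"
      using p \<tau> C morozov_rate by (intro exI[of _ ?C] conjI) auto
  qed
qed

end
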